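(* For every $C>1$ there exists $b_0>0$ such that for every $b>b_0$ and every $k\ge Cb/\ln b$, the mixing time and the relaxation time of the heat-bath Glauber dynamics for proper $k$-colorings of the star graph $G^*$ are $O(b\ln b)$.
   Context: $G^*$ is the star graph on $b+1$ vertices: a root $r$ adjacent to $b$ leaves. A proper $k$-coloring assigns colors from $\{1,\dots,k\}$ so adjacent vertices get distinct colors. The heat-bath Glauber dynamics picks a uniformly random vertex and recolors it uniformly among colors not used by its neighbors. Mixing time: $\min\{t:\max_\sigma\|P^t(\sigma,\cdot)-\pi\|_{TV}\le 1/(2e)\}$ with $\pi$ uniform on proper colorings; relaxation time: $1/(1-\lambda)$ with $\lambda$ the second largest eigenvalue in absolute value of the transition matrix. *)

theory Defs
  imports Complex_Main
begin

definition star_adj :: "nat \<Rightarrow> nat \<Rightarrow> nat \<Rightarrow> bool" where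
  "star_adj b u v \<longleftrightarrow> (u = 0 \<and> v \<in> {1..b}) \<or> (v = 0 \<and> u \<in> {1..b})"

definition colorings :: "nat \<Rightarrow> nat \<Rightarrow> (nat \<Rightarrow> nat) set" where
  "colorings b k = {f. (\<forall>i\<le>b. f i \<in> {1..k}) \<and> (\<forall>i>b. f i = 0)
                       \<and> (\<forall>u\<le>b. \<forall>v\<le>b. star_adj b u v \<longrightarrow> f u \<noteq> f v)}"

definition avail :: "nat \<Rightarrow> nat \<Rightarrow> (nat \<Rightarrow> nat) \<Rightarrow> nat \<Rightarrow> nat set" where
  "avail b k s v = {c\<in>{1..k}. \<forall>u\<le>b. star_adj b u v \<longrightarrow> s u \<noteq> c}"

definition glauber_P :: "nat \<Rightarrow> nat \<Rightarrow> (nat \<Rightarrow> nat) \<Rightarrow> (nat \<Rightarrow> nat) \<Rightarrow> real" where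
  "glauber_P b k s t = (1 / real (b + 1)) *
     (\<Sum>v\<in>{0..b}. if (\<forall>u. u \<noteq> v \<longrightarrow> t u = s u) \<and> t v \<in> avail b k s v
                   then 1 / real (card (avail b k s v)) else 0)"

fun glauber_Pt :: "nat \<Rightarrow> nat \<Rightarrow> nat \<Rightarrow> (nat \<Rightarrow> nat) \<Rightarrow> (nat \<Rightarrow> nat) \<Rightarrow> real" where
  "glauber_Pt b k 0 s t = (if s = t then 1 else 0)"
| "glauber_Pt b k (Suc n) s t = (\<Sum>r\<in>colorings b k. glauber_Pt b k n s r * glauber_P b k r t)"

definition tv_dist :: "nat \<Rightarrow> nat \<Rightarrow> nat \<Rightarrow> (nat \<Rightarrow> nat) \<Rightarrow> real" where
  "tv_dist b k n s = (1/2) * (\<Sum>t\<in>colorings b k.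
       \<bar>glauber_Pt b k n s t - 1 / real (card (colorings b k))\<bar>)"

definition mixes_by :: "nat \<Rightarrow> nat \<Rightarrow> nat \<Rightarrow> bool" where
  "mixes_by b k n \<longleftrightarrow> (\<forall>s\<in>colorings b k. tv_dist b k n s \<le> 1 / (2 * exp 1))"

definition mixing_time :: "nat \<Rightarrow> nat \<Rightarrow> nat" where
  "mixing_time b k = (LEAST n. mixes_by b k n)"

definition is_eigenvalue :: "nat \<Rightarrow> nat \<Rightarrow> real \<Rightarrow> bool" where
  "is_eigenvalue b k l \<longleftrightarrow> (\<exists>x :: (nat \<Rightarrow> nat) \<Rightarrow> real.
      (\<exists>s\<in>colorings b k. x s \<noteq> 0) \<and>
      (\<forall>s\<in>colorings b k. (\<Sum>t\<in>colorings b k. glauber_P b k s t * x t) = l * x s))"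

definition lambda_star :: "nat \<Rightarrow> nat \<Rightarrow> real" where
  "lambda_star b k = Max {\<bar>l\<bar> | l. is_eigenvalue b k l \<and> l \<noteq> 1}"

definition relaxation_time :: "nat \<Rightarrow> nat \<Rightarrow> real" where
  "relaxation_time b k = 1 / (1 - lambda_star b k)"

end

theory Submission
  imports Defs "HOL-Probability.Probability" "HOL-Real_Asymp.Real_Asymp"
begin

text \<open>Couple two copies of the chain by updating the same vertex in both and, at a leaf, by driving both
  updates with the same uniform element of \<^term>\<open>{1..k-1}\<close>. Once all leaves have been updated, the colours
  seen on the leaves of both copies agree with the most recent choices, except for \<^term>\<open>k\<close> and the colours
  that the two roots have used meanwhile: \<open>O(ln b)\<close> colours, since the root moves about once in \<open>b\<close> steps.
  On the other hand, the most recent choices are independent and uniform, so for \<open>k \<ge> C b / ln b\<close> they miss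
  polynomially many colours. Hence a root update gives both roots the same colour except with
  polynomially small probability. After such an update the roots keep agreeing with high probability,
  and the copies have coalesced when all leaves have been updated again. The spectral gap follows from the
  mixing bound at a single time, applied to a signed eigenvector of total mass 0.\<close>

section \<open>Asymptotics of the missing colours\<close>

text \<open>There may be far fewer colours than leaves. A colouring can then leave the root a single
  free colour, and a bound on one root update that is uniform over all colourings is worthless. What
  a typical update sees is read off the record of leaf choices instead. Freezing the whole sequence
  of moves leaves only the root colours random: along a fixed sequence, failure is bounded by a
  multiple of the sum of \<open>1 / (missing + 1)\<close> over the root moves. Whether blocks visit
  all vertices, how often the root moves, and this sum are then averaged separately, with no
  conditioning. The threshold \<open>C > 1\<close> enters only through the mean number of missed
  colours: for \<open>m = D * b / ln b\<close> it is about
  \<open>D * b powr (1 - 1/D) / ln b\<close>, a growing power of \<open>b\<close> when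
  \<open>D > 1\<close>. It has to beat the square of \<open>ln b\<close> that comes from the number
  of root moves times the number of colours on which the copies may disagree.\<close>

definition mean_missing :: "nat \<Rightarrow> nat \<Rightarrow> real" where
  "mean_missing b m = real m * (1 - 1 / real m) ^ b"

text \<open>With this many moves a given vertex is missed with probability at most
  \<open>1 / (b + 1)\<^sup>2\<close>, so a union bound over the vertices leaves
  \<open>1 / (b + 1)\<close>.\<close>

definition block_length :: "nat \<Rightarrow> nat" where
  "block_length b = nat \<lceil>2 * real (b + 1) * ln (real (b + 1))\<rceil>"

text \<open>Bounds the mean number of root moves during three blocks; the summand 3 absorbs the
  rounding in \<open>block_length\<close>.\<close>

definition root_moves_bound :: "nat \<Rightarrow> real" where
  "root_moves_bound b = 6 * ln (real b + 1) + 3"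

text \<open>\<open>mean_missing b m\<close> is the expected number of elements of an
  \<open>m\<close>-set that \<open>b\<close> independent uniform draws miss. It grows with
  \<open>m\<close>, and replacing \<open>m\<close> by any real lower bound \<open>y\<close> is what
  makes the later estimate uniform in \<open>k\<close>.\<close>

lemma mean_missing_lower:
  assumes y: "2 \<le> y" "y \<le> real m"
  shows "y * exp (- real b / y - 2 * (real b / y\<^sup>2)) \<le> mean_missing b m"
proof -
  have m: "2 \<le> real m" using y by simp
  let ?x = "1 / real m"
  have x: "0 \<le> ?x" "?x \<le> 1/2" using m by (auto simp: field_simps)
  have "?x \<le> 1 / y" using y by (intro divide_left_mono) auto
  moreover from this have "?x\<^sup>2 \<le> (1 / y)\<^sup>2" by (intro power_mono) auto
  ultimately have "- (1/y) - 2 * (1/y)\<^sup>2 \<le> - ?x - 2 * ?x\<^sup>2" by linarith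
  also have "\<dots> \<le> ln (1 - ?x)" using x by (rule ln_one_minus_pos_lower_bound)
  finally have le: "- (1/y) - 2 * (1/y)\<^sup>2 \<le> ln (1 - ?x)" .
  have "exp (- real b / y - 2 * (real b / y\<^sup>2)) = exp (real b * (- (1/y) - 2 * (1/y)\<^sup>2))"
    by (simp add: algebra_simps power_divide)
  also have "\<dots> \<le> exp (real b * ln (1 - ?x))"
    using le by (simp add: mult_left_mono)
  also have "\<dots> = (1 - ?x) ^ b" using x by (simp add: exp_of_nat_mult)
  finally show ?thesis unfolding mean_missing_def
    using y by (intro mult_mono) auto
qed

lemma ln_powr_vanishing:
  assumes "\<delta> > 0"
  shows "((\<lambda>x. (6 * ln (x+1) + 3) * (3 + 40 * (6 * ln (x+1) + 3)) * (12 * ln x * exp 1) / x powr \<delta>) 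
           \<longlongrightarrow> (0::real)) at_top"
  using assms by real_asymp

lemma root_failure_small:
  assumes "C > 1"
  shows "\<forall>\<^sub>F b in sequentially. \<forall>k. real k \<ge> C * real b / ln (real b) \<longrightarrow> 3 \<le> k \<and>
           root_moves_bound b * (2 * (3 + 40 * root_moves_bound b)) * (6 / mean_missing b (k - 1)) \<le> 1/20"
proof -
  \<comment> \<open>Any value strictly between 1 and \<open>C\<close> would do: \<open>D > 1\<close>
    keeps the exponent \<delta> positive, and the slack \<open>C - D\<close> pays for passing from
    \<open>k\<close> to \<open>k - 1\<close>.\<close>
  define D where "D = (1 + C) / 2"
  define \<delta> where "\<delta> = 1 - 1 / D"
  have D: "D > 1" "D < C" using assms by (auto simp: D_def)
  have \<delta>: "\<delta> > 0" using D by (simp add: \<delta>_def)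
  have CD: "C - D > 0" using D by simp
  have "\<forall>\<^sub>F x in at_top. (C - D) * (x / ln x) \<ge> (1::real)" using CD by real_asymp
  moreover have "\<forall>\<^sub>F x in at_top. x / ln x \<ge> (2::real)" by real_asymp
  \<comment> \<open>The second-order term of the exponent vanishes in the limit; bounding it by 1 is
    the origin of the factor \<open>exp 1\<close>.\<close>
  moreover have "\<forall>\<^sub>F x in at_top. 2 * (x / (x / ln x)\<^sup>2) \<le> (1::real)" by real_asymp
  moreover have "\<forall>\<^sub>F x in at_top. (6 * ln (x+1) + 3) * (3 + 40 * (6 * ln (x+1) + 3)) * (12 * ln x * exp 1) / x powr \<delta> < (1/20::real)"
    using ln_powr_vanishing[OF \<delta>] by (rule order_tendstoD) simp
  ultimately have "\<forall>\<^sub>F x in at_top. x > 1 \<and> (C - D) * (x / ln x) \<ge> (1::real) \<and> x / ln x \<ge> 2 \<and>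
      2 * (x / (x / ln x)\<^sup>2) \<le> 1 \<and> 
      (6 * ln (x+1) + 3) * (3 + 40 * (6 * ln (x+1) + 3)) * (12 * ln x * exp 1) / x powr \<delta> < 1/20"
    using eventually_gt_at_top[of "1::real"] by eventually_elim simp
  then have "\<forall>\<^sub>F b in sequentially. real b > 1 \<and> (C - D) * (real b / ln (real b)) \<ge> (1::real) \<and> real b / ln (real b) \<ge> 2 \<and>
      2 * (real b / (real b / ln (real b))\<^sup>2) \<le> 1 \<and> 
      (6 * ln (real b+1) + 3) * (3 + 40 * (6 * ln (real b+1) + 3)) * (12 * ln (real b) * exp 1) / real b powr \<delta> < 1/20"
    by (rule eventually_compose_filterlim[OF _ filterlim_real_sequentially])
  then show ?thesis
  proof eventually_elim
    case (elim b)
    define x where "x = real b"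
    define y where "y = x / ln x"
    have x: "x > 1" and y: "1 \<le> (C - D) * y" "2 \<le> y" "2 * (x / y\<^sup>2) \<le> 1"
      and sm: "(6 * ln (x+1) + 3) * (3 + 40 * (6 * ln (x+1) + 3)) * (12 * ln x * exp 1) / x powr \<delta> < 1/20"
      using elim unfolding x_def y_def by auto
    show ?case
    proof (intro allI impI)
      fix k assume "real k \<ge> C * real b / ln (real b)"
      then have k: "real k \<ge> C * y" by (simp add: x_def y_def)
      have Dy: "y \<le> D * y" using D y by simp
      have k1: "real k \<ge> D * y + 1" using k y by (simp add: algebra_simps)
      then have k3: "3 \<le> k" using Dy y by linarith
      then have m: "D * y \<le> real (k - 1)" using k1 by (simp add: of_nat_diff)
      have lx: "ln x > 0" using x by simp
      have "x / (D * y) = ln x / D" using x lx by (simp add: y_def)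
      moreover have "x / (D * y)\<^sup>2 \<le> x / y\<^sup>2"
        using Dy y x D by (intro divide_left_mono power_mono) auto
      ultimately have ex: "- ln x / D - 1 \<le> - x / (D * y) - 2 * (x / (D * y)\<^sup>2)"
        using y(3) unfolding minus_divide_left[symmetric] by linarith
      have "x powr \<delta> / (ln x * exp 1) = y * exp (- ln x / D - 1)"
      proof -
        have "x powr \<delta> = exp (ln x + - ln x / D)"
          using x by (simp add: powr_def \<delta>_def left_diff_distrib)
        also have "\<dots> = x * exp (- ln x / D)" using x by (subst exp_add) simp
        finally show ?thesis by (simp add: y_def exp_diff)
      qed
      also have "\<dots> \<le> (D * y) * exp (- x / (D * y) - 2 * (x / (D * y)\<^sup>2))"
        using Dy y ex by (intro mult_mono) auto
      also have "\<dots> \<le> mean_missing b (k - 1)"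
        unfolding x_def using mean_missing_lower[OF _ m] Dy y by simp
      finally have mu: "x powr \<delta> / (ln x * exp 1) \<le> mean_missing b (k - 1)" .
      have pos: "0 < x powr \<delta> / (ln x * exp 1)" using x lx by simp
      have "6 / mean_missing b (k - 1) \<le> 6 / (x powr \<delta> / (ln x * exp 1))"
        using mu pos by (intro divide_left_mono mult_pos_pos) auto
      also have "\<dots> = 6 * (ln x * exp 1) / x powr \<delta>" by simp
      finally have "6 / mean_missing b (k - 1) \<le> 6 * (ln x * exp 1) / x powr \<delta>" .
      moreover have "0 \<le> ln (x + 1)" using x by simp
      ultimately have "root_moves_bound b * (2 * (3 + 40 * root_moves_bound b)) * (6 / mean_missing b (k - 1))
        \<le> root_moves_bound b * (2 * (3 + 40 * root_moves_bound b)) * (6 * (ln x * exp 1) / x powr \<delta>)"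
        unfolding root_moves_bound_def x_def[symmetric] by (intro mult_left_mono) auto
      also have "\<dots> = (6 * ln (x+1) + 3) * (3 + 40 * (6 * ln (x+1) + 3)) * (12 * ln x * exp 1) / x powr \<delta>"
        unfolding root_moves_bound_def x_def[symmetric] by simp
      finally show "3 \<le> k \<and> root_moves_bound b * (2 * (3 + 40 * root_moves_bound b)) * (6 / mean_missing b (k - 1)) \<le> 1/20"
        using sm k3 by simp
    qed
  qed
qed

section \<open>Length of a block of moves\<close>

lemma block_length_bounds:
  assumes "b \<ge> 2"
  shows "2 * real (b + 1) * ln (real (b + 1)) \<le> real (block_length b)"
    "real (block_length b) \<le> 2 * real (b + 1) * ln (real (b + 1)) + 1"
  using assms unfolding block_length_def by (simp_all add: of_nat_ceiling)

lemma unvisited_bound: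
  assumes "b \<ge> 2"
  shows "real (b + 1) * (1 - 1 / real (b + 1)) ^ block_length b \<le> 1 / real (b + 1)"
proof -
  let ?a = "real (b + 1)" and ?N = "block_length b"
  have "(1 - 1 / ?a) ^ ?N \<le> exp (- (1 / ?a)) ^ ?N"
    using exp_ge_add_one_self[of "- (1 / ?a)"] by (intro power_mono) auto
  also have "\<dots> = exp (- (real ?N / ?a))" by (simp flip: exp_of_nat_mult)
  also have "\<dots> \<le> exp (- (2 * ln ?a))"
    using block_length_bounds(1)[OF assms] by (simp add: field_simps)
  also have "\<dots> = 1 / ?a\<^sup>2"
    by (simp add: exp_minus exp_double inverse_eq_divide power2_eq_square)
  finally have "?a * (1 - 1 / ?a) ^ ?N \<le> ?a * (1 / ?a\<^sup>2)"
    by (rule mult_left_mono) simp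
  then show ?thesis
    by (simp add: power2_eq_square)
qed

lemma blocks_per_vertex:
  assumes "b \<ge> 2"
  shows "real (3 * block_length b) / real (b + 1) \<le> root_moves_bound b"
proof -
  have "real (3 * block_length b) \<le> 3 * (2 * real (b + 1) * ln (real (b + 1)) + 1)"
    using block_length_bounds(2)[OF assms] by simp
  also have "\<dots> \<le> root_moves_bound b * real (b + 1)"
    by (simp add: root_moves_bound_def algebra_simps)
  finally show ?thesis by (simp add: field_simps)
qed

text \<open>The summand 1 is the one lost in \<open>relaxation_time_le\<close>, so that one constant
  serves both times. The constant is 30 = 18 + 12: \<open>6 * (3/2) * 2\<close> from the main term,
  and 12 as a crude allowance for the additive 4.\<close>

lemma three_blocks_le:
  assumes "b \<ge> 2"
  shows "real (3 * block_length b) + 1 \<le> 30 * real b * ln (real b)"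
proof -
  let ?x = "real b"
  have x: "?x \<ge> 2" using assms by simp
  have "1/2 \<le> ln (2::real)" using ln_le_minus_one[of "1/2::real"] by (simp add: ln_div)
  also have "\<dots> \<le> ln ?x" using x by simp
  finally have l: "1/2 \<le> ln ?x" .
  have "ln (?x + 1) \<le> ln (?x\<^sup>2)" using x by (intro ln_mono) (auto simp: power2_eq_square intro: order_trans[of _ "2 * ?x"])
  then have l1: "ln (?x + 1) \<le> 2 * ln ?x" using x by (simp add: ln_realpow)
  have "real (3 * block_length b) + 1 \<le> 6 * (?x + 1) * ln (?x + 1) + 4"
    using block_length_bounds(2)[OF assms] by (simp add: algebra_simps)
  also have "\<dots> \<le> 6 * (3/2 * ?x) * (2 * ln ?x) + 4"
    using x l1 l by (intro add_mono mult_mono) auto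
  also have "4 \<le> 12 * (?x * ln ?x)"
    using mult_mono[OF x l] x by simp
  finally show ?thesis by simp
qed

section \<open>Colorings and eigenvalues\<close>

text \<open>Bessel's inequality for the unit vector at each \<open>s\<close>, summed over
  \<open>s\<close>: the total mass of the family is \<open>card E\<close> when counted by vectors
  and at most \<open>card S\<close> when counted by coordinates.\<close>

lemma orthonormal_card_le:
  fixes y :: "'l \<Rightarrow> 'a \<Rightarrow> real"
  assumes S: "finite S" and E: "finite E"
    and unit: "\<And>l. l \<in> E \<Longrightarrow> (\<Sum>t\<in>S. (y l t)\<^sup>2) = 1"
    and orth: "\<And>l l'. l \<in> E \<Longrightarrow> l' \<in> E \<Longrightarrow> l \<noteq> l' \<Longrightarrow> (\<Sum>t\<in>S. y l t * y l' t) = 0"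
  shows "card E \<le> card S"
proof -
  have square: "(\<Sum>t\<in>S. (d t - p t)\<^sup>2) = (\<Sum>t\<in>S. d t * d t) - 2 * (\<Sum>t\<in>S. d t * p t) + (\<Sum>t\<in>S. p t * p t)"
    for d p :: "'a \<Rightarrow> real"
    by (simp add: power2_eq_square algebra_simps sum.distrib sum_subtractf sum_distrib_left)
  have bessel: "(\<Sum>l\<in>E. (y l s)\<^sup>2) \<le> 1" if s: "s \<in> S" for s
  proof -
    \<comment> \<open>\<open>?p\<close> is the projection of the unit vector \<open>?d\<close> onto
      the span of the family. Its inner products with \<open>?d\<close> and with itself both equal
      \<open>?p s\<close>, so the squared distance of the two is \<open>1 - ?p s\<close>.\<close>
    let ?p = "\<lambda>t. \<Sum>l\<in>E. y l s * y l t"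
    let ?d = "\<lambda>t. if t = s then 1 else (0::real)"
    have "(\<Sum>t\<in>S. ?d t * ?d t) = 1" 
      using S s by (simp add: if_distrib[of "\<lambda>z. z * _"] sum.delta' cong: if_cong)
    moreover have "(\<Sum>t\<in>S. ?d t * ?p t) = ?p s" 
      using S s by (simp add: if_distrib[of "\<lambda>z. z * _"] sum.delta' cong: if_cong)
    moreover have "(\<Sum>t\<in>S. ?p t * ?p t) = ?p s"
    proof -
      have "(\<Sum>t\<in>S. ?p t * ?p t) = (\<Sum>t\<in>S. \<Sum>l\<in>E. \<Sum>l'\<in>E. y l s * y l' s * (y l t * y l' t))"
        by (simp add: sum_product mult_ac)
      also have "\<dots> = (\<Sum>l\<in>E. \<Sum>l'\<in>E. y l s * y l' s * (\<Sum>t\<in>S. y l t * y l' t))"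
        by (simp add: sum_distrib_left sum.swap[of _ _ S])
      also have "\<dots> = (\<Sum>l\<in>E. \<Sum>l'\<in>E. if l' = l then y l s * y l s else 0)"
        using unit orth by (intro sum.cong refl) (auto simp: power2_eq_square)
      also have "\<dots> = ?p s" using E by simp
      finally show ?thesis .
    qed
    moreover have "0 \<le> (\<Sum>t\<in>S. (?d t - ?p t)\<^sup>2)" by (intro sum_nonneg) simp
    moreover have "(\<Sum>t\<in>S. (?d t - ?p t)\<^sup>2) = (\<Sum>t\<in>S. ?d t * ?d t) - 2 * (\<Sum>t\<in>S. ?d t * ?p t) + (\<Sum>t\<in>S. ?p t * ?p t)"
      by (rule square)
    ultimately have "?p s \<le> 1" by linarith
    then show ?thesis by (simp add: power2_eq_square)
  qed
  have "real (card E) = (\<Sum>l\<in>E. \<Sum>s\<in>S. (y l s)\<^sup>2)" using unit by simp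
  also have "\<dots> = (\<Sum>s\<in>S. \<Sum>l\<in>E. (y l s)\<^sup>2)" by (rule sum.swap)
  also have "\<dots> \<le> (\<Sum>s\<in>S. 1)" using bessel by (intro sum_mono)
  finally show ?thesis by simp
qed

text \<open>Eigenvectors of a symmetric kernel for distinct eigenvalues are orthogonal, so
  \<open>card S + 1\<close> eigenvalues would give too large an orthonormal family. Finiteness is
  what gives the \<open>Max\<close> in \<open>lambda_star\<close> its meaning.\<close>

lemma finite_eigenvalues_symmetric:
  fixes K :: "'a \<Rightarrow> 'a \<Rightarrow> real"
  assumes S: "finite S" and sym: "\<And>s t. s \<in> S \<Longrightarrow> t \<in> S \<Longrightarrow> K s t = K t s"
  shows "finite {l. \<exists>x. (\<exists>s\<in>S. x s \<noteq> 0) \<and> (\<forall>s\<in>S. (\<Sum>t\<in>S. K s t * x t) = l * x s)}"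
    (is "finite ?L")
proof (rule ccontr)
  assume "infinite ?L"
  then obtain E where E: "finite E" "card E = Suc (card S)" "E \<subseteq> ?L"
    using infinite_arbitrarily_large by blast
  from E(3) have "\<forall>l\<in>E. \<exists>x. (\<exists>s\<in>S. x s \<noteq> 0) \<and> (\<forall>s\<in>S. (\<Sum>t\<in>S. K s t * x t) = l * x s)" by blast
  then obtain x where nz: "\<And>l. l \<in> E \<Longrightarrow> \<exists>s\<in>S. x l s \<noteq> 0"
    and eig: "\<And>l s. l \<in> E \<Longrightarrow> s \<in> S \<Longrightarrow> (\<Sum>t\<in>S. K s t * x l t) = l * x l s"
    unfolding bchoice_iff by blast
  define n where "n l = (\<Sum>t\<in>S. (x l t)\<^sup>2)" for l
  have n: "n l > 0" if "l \<in> E" for l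
    using nz[OF that] S unfolding n_def by (metis sum_pos2 zero_le_power2 zero_less_power2)
  define y where "y l t = x l t / sqrt (n l)" for l t
  have orth: "(\<Sum>t\<in>S. x l t * x l' t) = 0" if l: "l \<in> E" "l' \<in> E" "l \<noteq> l'" for l l'
  proof -
    have "l * (\<Sum>t\<in>S. x l t * x l' t) = (\<Sum>s\<in>S. (\<Sum>t\<in>S. K s t * x l t) * x l' s)"
      using eig[OF l(1)] by (simp add: sum_distrib_left mult_ac)
    also have "\<dots> = (\<Sum>s\<in>S. \<Sum>t\<in>S. K t s * x l t * x l' s)"
      using sym by (auto simp: sum_distrib_right intro!: sum.cong)
    also have "\<dots> = (\<Sum>t\<in>S. (\<Sum>s\<in>S. K t s * x l' s) * x l t)"
      by (subst sum.swap) (simp add: sum_distrib_right sum_distrib_left mult_ac)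
    also have "\<dots> = l' * (\<Sum>t\<in>S. x l t * x l' t)"
      using eig[OF l(2)] by (simp add: sum_distrib_left mult_ac)
    finally show ?thesis using l(3) by simp
  qed
  have "card E \<le> card S"
  proof (rule orthonormal_card_le[where y = y])
    fix l assume l: "l \<in> E"
    have "(\<Sum>t\<in>S. (y l t)\<^sup>2) = (\<Sum>t\<in>S. (x l t)\<^sup>2) / n l"
      using n[OF l] by (simp add: y_def power_divide sum_divide_distrib)
    then show "(\<Sum>t\<in>S. (y l t)\<^sup>2) = 1" using n[OF l] by (simp add: n_def)
  next
    fix l l' assume "l \<in> E" "l' \<in> E" "l \<noteq> l'"
    then show "(\<Sum>t\<in>S. y l t * y l' t) = 0"
      using orth by (simp add: y_def sum_divide_distrib[symmetric])
  qed (use S E in auto)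
  then show False using E by simp
qed

lemma finite_colorings [simp]: "finite (colorings b k)"
proof (rule finite_subset)
  show "colorings b k \<subseteq> {f. \<forall>x. (x \<in> {..b} \<longrightarrow> f x \<in> {1..k}) \<and> (x \<notin> {..b} \<longrightarrow> f x = 0)}"
    by (auto simp: colorings_def)
  show "finite {f. \<forall>x. (x \<in> {..b} \<longrightarrow> f x \<in> {1..k}) \<and> (x \<notin> {..b} \<longrightarrow> f x = (0::nat))}"
    by (rule finite_set_of_finite_funs) auto
qed

lemma colorings_iff:
  "s \<in> colorings b k \<longleftrightarrow> (\<forall>i\<le>b. s i \<in> {1..k}) \<and> (\<forall>i>b. s i = 0) \<and> s 0 \<notin> s ` {1..b}"
proof -
  have "(\<forall>u\<le>b. \<forall>v\<le>b. star_adj b u v \<longrightarrow> s u \<noteq> s v) \<longleftrightarrow> s 0 \<notin> s ` {1..b}"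
  proof
    assume *: "\<forall>u\<le>b. \<forall>v\<le>b. star_adj b u v \<longrightarrow> s u \<noteq> s v"
    have "s 0 \<noteq> s v" if "v \<in> {1..b}" for v using *[rule_format, of 0 v] that by (simp add: star_adj_def)
    then show "s 0 \<notin> s ` {1..b}" by blast
  next
    assume *: "s 0 \<notin> s ` {1..b}"
    then have "s 0 \<noteq> s v" if "v \<in> {1..b}" for v using that by blast
    then show "\<forall>u\<le>b. \<forall>v\<le>b. star_adj b u v \<longrightarrow> s u \<noteq> s v" unfolding star_adj_def by metis
  qed
  then show ?thesis by (simp add: colorings_def)
qed

lemma avail_root: "avail b k s 0 = {1..k} - s ` {1..b}"
  unfolding avail_def star_adj_def by fastforce

lemma avail_leaf: "v \<in> {1..b} \<Longrightarrow> avail b k s v = {1..k} - {s 0}"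
  unfolding avail_def star_adj_def by fastforce

lemma finite_avail [simp]: "finite (avail b k s v)"
  by (simp add: avail_def)

lemma avail_cong: "(\<And>u. u \<noteq> v \<Longrightarrow> t u = s u) \<Longrightarrow> avail b k t v = avail b k s v"
  unfolding avail_def star_adj_def by (intro Collect_cong) fastforce

lemma colour_in_avail: "s \<in> colorings b k \<Longrightarrow> v \<le> b \<Longrightarrow> s v \<in> avail b k s v"
  unfolding avail_def colorings_def by fastforce

lemma avail_nonempty: "s \<in> colorings b k \<Longrightarrow> v \<le> b \<Longrightarrow> avail b k s v \<noteq> {}"
  using colour_in_avail by blast

lemma recolour_in_colorings:
  assumes "s \<in> colorings b k" "v \<le> b" "c \<in> avail b k s v"
  shows "s(v := c) \<in> colorings b k"
proof (cases "v = 0")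
  case True
  then show ?thesis using assms by (auto simp: colorings_iff avail_root image_iff)
next
  case False
  then have "v \<in> {1..b}" using assms by simp
  then show ?thesis using assms by (auto simp: colorings_iff avail_leaf image_iff)
qed

text \<open>Colourings that differ at most at \<open>v\<close> have the same available colours at
  \<open>v\<close>. Symmetry makes the uniform law stationary and the eigenvalue argument above
  applicable.\<close>

lemma glauber_P_sym:
  assumes "s \<in> colorings b k" "t \<in> colorings b k"
  shows "glauber_P b k s t = glauber_P b k t s"
proof -
  have "((\<forall>u. u \<noteq> v \<longrightarrow> t u = s u) \<and> t v \<in> avail b k s v) = ((\<forall>u. u \<noteq> v \<longrightarrow> s u = t u) \<and> s v \<in> avail b k t v)
      \<and> ((\<forall>u. u \<noteq> v \<longrightarrow> t u = s u) \<longrightarrow> avail b k s v = avail b k t v)" if "v \<in> {0..b}" for v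
    using avail_cong[of v t s b k] colour_in_avail[OF assms(1), of v] colour_in_avail[OF assms(2), of v] that
    by auto
  then show ?thesis
    unfolding glauber_P_def by (intro arg_cong2[where f = "(*)"] sum.cong refl) (metis (no_types, lifting))
qed

lemma finite_eigenvalues: "finite {l. is_eigenvalue b k l}"
  unfolding is_eigenvalue_def
  using finite_eigenvalues_symmetric[OF finite_colorings glauber_P_sym] .

definition heat_bath :: "nat \<Rightarrow> nat \<Rightarrow> (nat \<Rightarrow> nat) \<Rightarrow> (nat \<Rightarrow> nat) pmf" where
  "heat_bath b k s = do {v \<leftarrow> pmf_of_set {0..b}; map_pmf (\<lambda>c. s(v := c)) (pmf_of_set (avail b k s v))}"

lemma set_heat_bath: "s \<in> colorings b k \<Longrightarrow> set_pmf (heat_bath b k s) \<subseteq> colorings b k"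
  by (auto simp: heat_bath_def set_pmf_of_set avail_nonempty intro: recolour_in_colorings)

lemma pmf_heat_bath:
  assumes s: "s \<in> colorings b k"
  shows "pmf (heat_bath b k s) t = glauber_P b k s t"
proof -
  have "pmf (map_pmf (\<lambda>c. s(v := c)) (pmf_of_set (avail b k s v))) t =
      (if (\<forall>u. u \<noteq> v \<longrightarrow> t u = s u) \<and> t v \<in> avail b k s v then 1 / real (card (avail b k s v)) else 0)"
    if v: "v \<in> {0..b}" for v
  proof -
    let ?A = "avail b k s v"
    have inj: "inj_on (\<lambda>c. s(v := c)) ?A" by (rule inj_onI) (metis fun_upd_same)
    have A: "?A \<noteq> {}" using avail_nonempty[OF s] v by simp
    have "t \<in> (\<lambda>c. s(v := c)) ` ?A \<longleftrightarrow> (\<forall>u. u \<noteq> v \<longrightarrow> t u = s u) \<and> t v \<in> ?A"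
      by (auto simp: image_iff fun_eq_iff) 
    moreover have "card ((\<lambda>c. s(v := c)) ` ?A) = card ?A" using inj by (rule card_image)
    ultimately show ?thesis
      using A by (simp add: map_pmf_of_set_inj[OF inj] indicator_def)
  qed
  then show ?thesis
    by (simp add: heat_bath_def pmf_bind_pmf_of_set glauber_P_def)
qed

lemma glauber_P_row_sum:
  assumes "s \<in> colorings b k"
  shows "(\<Sum>t\<in>colorings b k. glauber_P b k s t) = 1"
  using sum_pmf_eq_1[OF finite_colorings set_heat_bath[OF assms]] assms by (simp add: pmf_heat_bath)

lemma glauber_P_apply:
  assumes s: "s \<in> colorings b k"
  shows "(\<Sum>t\<in>colorings b k. glauber_P b k s t * f t) =
    (\<Sum>v\<in>{0..b}. (\<Sum>c\<in>avail b k s v. f (s(v := c))) / real (card (avail b k s v))) / real (b + 1)"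
proof -
  have "(\<Sum>t\<in>colorings b k. glauber_P b k s t * f t) = measure_pmf.expectation (heat_bath b k s) f"
    by (subst integral_measure_pmf_real[OF finite_colorings])
       (use set_heat_bath[OF s] in \<open>auto simp: pmf_heat_bath[OF s] mult.commute\<close>)
  also have "\<dots> = (\<Sum>v\<in>{0..b}. measure_pmf.expectation (map_pmf (\<lambda>c. s(v := c)) (pmf_of_set (avail b k s v))) f) / real (b + 1)"
    unfolding heat_bath_def using avail_nonempty[OF s]
    by (subst pmf_expectation_bind_pmf_of_set) (auto simp: divide_inverse mult.commute sum_distrib_left)
  also have "(\<Sum>v\<in>{0..b}. measure_pmf.expectation (map_pmf (\<lambda>c. s(v := c)) (pmf_of_set (avail b k s v))) f) = 
    (\<Sum>v\<in>{0..b}. (\<Sum>c\<in>avail b k s v. f (s(v := c))) / real (card (avail b k s v)))"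
    using avail_nonempty[OF s] by (intro sum.cong refl) (simp add: integral_pmf_of_set)
  finally show ?thesis .
qed

text \<open>Ensures that the \<open>Max\<close> in \<open>lambda_star\<close> is over a nonempty
  set. The eigenfunction is the colour difference of two leaves: updating either one replaces its
  colour by the same mean over the colours other than \<open>s 0\<close>, so the two means cancel,
  and the \<open>b - 1\<close> other updates leave the difference alone.\<close>

lemma is_eigenvalue_leaf_difference:
  assumes b: "2 \<le> b" and k: "3 \<le> k"
  shows "is_eigenvalue b k (real b / real (b + 1))"
proof -
  define x :: "(nat \<Rightarrow> nat) \<Rightarrow> real" where "x s = real (s 1) - real (s 2)" for s
  have "(\<Sum>t\<in>colorings b k. glauber_P b k s t * x t) = real b / real (b + 1) * x s"
    if s: "s \<in> colorings b k" for s
  proof -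
    let ?A = "{1..k} - {s 0}"
    let ?g = "\<lambda>v. (\<Sum>c\<in>avail b k s v. x (s(v := c))) / real (card (avail b k s v))"
    have A: "finite ?A" "card ?A \<noteq> 0" using avail_nonempty[OF s, of 1] b by (auto simp: avail_leaf)
    have "{0..b} = insert 1 (insert 2 ({0..b} - {1,2}))" using b by auto
    then have "(\<Sum>v\<in>{0..b}. ?g v) = (\<Sum>v\<in>insert 1 (insert 2 ({0..b} - {1,2})). ?g v)" by simp
    also have "\<dots> = ?g 1 + ?g 2 + (\<Sum>v\<in>{0..b} - {1,2}. ?g v)"
      by simp
    also have "(\<Sum>v\<in>{0..b} - {1,2}. ?g v) = (\<Sum>v\<in>{0..b} - {1,2}. x s)"
      using avail_nonempty[OF s] by (intro sum.cong refl) (simp add: x_def)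
    also have "?g 1 = (\<Sum>c\<in>?A. real c) / real (card ?A) - real (s 2)"
      using b A by (simp add: avail_leaf x_def sum_subtractf diff_divide_distrib del: card_Diff_insert)
    also have "?g 2 = real (s 1) - (\<Sum>c\<in>?A. real c) / real (card ?A)"
      using b A by (simp add: avail_leaf x_def sum_subtractf diff_divide_distrib del: card_Diff_insert)
    finally have "(\<Sum>v\<in>{0..b}. ?g v) = x s + real (card ({0..b} - {1,2})) * x s"
      unfolding x_def sum_constant by linarith
    also have "card ({0..b} - {1,2}) = b - 1" using b by (subst card_Diff_subset) auto
    also have "x s + real (b - 1) * x s = real b * x s" using b by (simp add: algebra_simps of_nat_diff)
    finally have total: "(\<Sum>v\<in>{0..b}. ?g v) = real b * x s" .
    show ?thesis unfolding glauber_P_apply[OF s] total by simp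
  qed
  moreover have "\<exists>s\<in>colorings b k. x s \<noteq> 0"
  proof
    show "(\<lambda>i. if i = 0 then 1 else if i = 1 then 2 else if i \<le> b then 3 else 0) \<in> colorings b k"
      using b k by (auto simp: colorings_iff)
  qed (use b in \<open>simp add: x_def\<close>)
  ultimately show ?thesis unfolding is_eigenvalue_def by blast
qed

section \<open>Total variation and relaxation\<close>

text \<open>The definition of the powers appends a step at the end; both symmetry and the comparison
  with coupled runs need to split off the step at the beginning.\<close>

lemma glauber_Pt_Suc:
  assumes "s \<in> colorings b k" "t \<in> colorings b k"
  shows "glauber_Pt b k (Suc n) s t = (\<Sum>r\<in>colorings b k. glauber_P b k s r * glauber_Pt b k n r t)"
  using assms(2)
proof (induction n arbitrary: t)
  case 0
  have "glauber_Pt b k (Suc 0) s t = (\<Sum>r\<in>colorings b k. if r = s then glauber_P b k r t else 0)"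
    by (simp add: if_distrib[of "\<lambda>z. z * _"] eq_commute cong: if_cong)
  also have "\<dots> = glauber_P b k s t" using assms(1) by simp
  also have "\<dots> = (\<Sum>r\<in>colorings b k. glauber_P b k s r * glauber_Pt b k 0 r t)"
    using 0 by (simp add: if_distrib[of "\<lambda>z. _ * z"] cong: if_cong)
  finally show ?case .
next
  case (Suc n)
  have "glauber_Pt b k (Suc (Suc n)) s t =
      (\<Sum>r\<in>colorings b k. (\<Sum>q\<in>colorings b k. glauber_P b k s q * glauber_Pt b k n q r) * glauber_P b k r t)"
    using Suc.IH by (subst glauber_Pt.simps(2)) (intro sum.cong, auto simp del: glauber_Pt.simps)
  also have "\<dots> = (\<Sum>q\<in>colorings b k. glauber_P b k s q * (\<Sum>r\<in>colorings b k. glauber_Pt b k n q r * glauber_P b k r t))"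
    by (simp add: sum_distrib_left sum_distrib_right mult_ac) (rule sum.swap)
  finally show ?case by simp
qed

lemma glauber_Pt_sym:
  assumes "s \<in> colorings b k" "t \<in> colorings b k"
  shows "glauber_Pt b k n s t = glauber_Pt b k n t s"
  using assms
proof (induction n arbitrary: s t)
  case 0
  then show ?case by auto
next
  case (Suc n)
  have "glauber_Pt b k (Suc n) s t = (\<Sum>r\<in>colorings b k. glauber_P b k t r * glauber_Pt b k n r s)"
    using Suc by (auto simp: glauber_P_sym[of _ b k t] mult.commute intro!: sum.cong)
  also have "\<dots> = glauber_Pt b k (Suc n) t s"
    using Suc.prems by (intro glauber_Pt_Suc[symmetric])
  finally show ?case .
qed

lemma glauber_Pt_row_sum:
  assumes "s \<in> colorings b k"
  shows "(\<Sum>t\<in>colorings b k. glauber_Pt b k n s t) = 1"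
  using assms
proof (induction n)
  case 0
  then show ?case by simp
next
  case (Suc n)
  have "(\<Sum>t\<in>colorings b k. glauber_Pt b k (Suc n) s t) =
      (\<Sum>r\<in>colorings b k. glauber_Pt b k n s r * (\<Sum>t\<in>colorings b k. glauber_P b k r t))"
    by (simp add: sum_distrib_left) (rule sum.swap)
  also have "\<dots> = (\<Sum>r\<in>colorings b k. glauber_Pt b k n s r)"
    by (intro sum.cong refl) (simp add: glauber_P_row_sum)
  finally show ?case using Suc by simp
qed

text \<open>By symmetry the columns of the \<open>n\<close>-step kernel also sum to 1, so the
  uniform mass at \<open>t\<close> is the average over \<open>s'\<close> of the mass at
  \<open>t\<close> when starting from \<open>s'\<close>.\<close>

lemma tv_dist_le_if_pairwise:
  assumes s: "s \<in> colorings b k"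
    and pair: "\<And>s'. s' \<in> colorings b k \<Longrightarrow>
      (\<Sum>t\<in>colorings b k. \<bar>glauber_Pt b k n s t - glauber_Pt b k n s' t\<bar>) \<le> 2 * e"
  shows "tv_dist b k n s \<le> e"
proof -
  let ?S = "colorings b k"
  have N: "real (card ?S) > 0" using s by (auto simp: card_gt_0_iff)
  have "\<bar>glauber_Pt b k n s t - 1 / real (card ?S)\<bar> \<le>
      (\<Sum>s'\<in>?S. \<bar>glauber_Pt b k n s t - glauber_Pt b k n s' t\<bar>) / real (card ?S)" if t: "t \<in> ?S" for t
  proof -
    have "(\<Sum>s'\<in>?S. glauber_Pt b k n s' t) = (\<Sum>s'\<in>?S. glauber_Pt b k n t s')"
      using t by (intro sum.cong refl glauber_Pt_sym)
    then have "(\<Sum>s'\<in>?S. glauber_Pt b k n s t - glauber_Pt b k n s' t) = real (card ?S) * glauber_Pt b k n s t - 1"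
      using glauber_Pt_row_sum[OF t] by (simp add: sum_subtractf)
    then have "glauber_Pt b k n s t - 1 / real (card ?S) =
        (\<Sum>s'\<in>?S. glauber_Pt b k n s t - glauber_Pt b k n s' t) / real (card ?S)"
      using N t by (simp only: diff_divide_distrib) auto
    then show ?thesis using N by (simp add: abs_divide divide_right_mono sum_abs)
  qed
  then have "(\<Sum>t\<in>?S. \<bar>glauber_Pt b k n s t - 1 / real (card ?S)\<bar>) \<le>
      (\<Sum>t\<in>?S. (\<Sum>s'\<in>?S. \<bar>glauber_Pt b k n s t - glauber_Pt b k n s' t\<bar>) / real (card ?S))"
    by (rule sum_mono)
  also have "\<dots> = (\<Sum>s'\<in>?S. \<Sum>t\<in>?S. \<bar>glauber_Pt b k n s t - glauber_Pt b k n s' t\<bar>) / real (card ?S)"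
    by (subst sum.swap) (simp add: sum_divide_distrib)
  also have "\<dots> \<le> (\<Sum>s'\<in>?S. 2 * e) / real (card ?S)"
    using pair by (intro divide_right_mono sum_mono) auto
  also have "\<dots> = 2 * e" using N s by auto
  finally show ?thesis by (simp add: tv_dist_def)
qed

text \<open>Evaluate the eigenvector equation for the \<open>n\<close>-th power at a point where
  \<open>\<bar>x\<bar>\<close> is maximal. Since \<open>x\<close> sums to 0, the uniform law can be
  subtracted from the kernel for free, leaving a sum bounded by twice the total variation distance
  times the maximum.\<close>

lemma eigenvalue_power_le:
  assumes mix: "mixes_by b k n" and l: "is_eigenvalue b k l" "l \<noteq> 1"
  shows "\<bar>l\<bar> ^ n \<le> exp (-1)"
proof -
  let ?S = "colorings b k"
  obtain x where nz: "\<exists>s\<in>?S. x s \<noteq> 0"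
    and eig: "\<And>s. s \<in> ?S \<Longrightarrow> (\<Sum>t\<in>?S. glauber_P b k s t * x t) = l * x s"
    using l(1) unfolding is_eigenvalue_def by blast
  have pow: "(\<Sum>t\<in>?S. glauber_Pt b k n s t * x t) = l ^ n * x s" if "s \<in> ?S" for s
    using that
  proof (induction n)
    case 0
    then show ?case by (simp add: if_distrib[of "\<lambda>z. z * _"] cong: if_cong)
  next
    case (Suc n)
    have "(\<Sum>t\<in>?S. glauber_Pt b k (Suc n) s t * x t) =
        (\<Sum>r\<in>?S. glauber_Pt b k n s r * (\<Sum>t\<in>?S. glauber_P b k r t * x t))"
      by (simp add: sum_distrib_left sum_distrib_right mult_ac) (rule sum.swap)
    also have "\<dots> = (\<Sum>r\<in>?S. glauber_Pt b k n s r * (l * x r))"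
      by (intro sum.cong refl) (simp add: eig)
    also have "\<dots> = l * (\<Sum>r\<in>?S. glauber_Pt b k n s r * x r)"
      by (simp add: sum_distrib_left mult_ac)
    finally show ?case using Suc by simp
  qed
  \<comment> \<open>Columns sum to 1, so summing the eigenvector equation gives \<open>l\<close>
    times the total equal to the total; \<open>l \<noteq> 1\<close> forces the total to be
    0.\<close>
  have "(\<Sum>s\<in>?S. l * x s) = (\<Sum>s\<in>?S. \<Sum>t\<in>?S. glauber_P b k s t * x t)"
    by (intro sum.cong refl) (simp add: eig)
  also have "\<dots> = (\<Sum>t\<in>?S. \<Sum>s\<in>?S. glauber_P b k t s * x t)"
    by (subst sum.swap) (intro sum.cong refl, simp add: glauber_P_sym)
  also have "\<dots> = (\<Sum>t\<in>?S. x t)"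
    by (intro sum.cong refl) (simp add: glauber_P_row_sum flip: sum_distrib_right)
  finally have zero: "(\<Sum>t\<in>?S. x t) = 0" using l(2) by (simp flip: sum_distrib_left)
  have ne: "?S \<noteq> {}" using nz by blast
  define M where "M = Max ((\<lambda>s. \<bar>x s\<bar>) ` ?S)"
  have le: "\<bar>x s\<bar> \<le> M" if "s \<in> ?S" for s unfolding M_def using that by (intro Max_ge) auto
  have "M \<in> (\<lambda>s. \<bar>x s\<bar>) ` ?S" unfolding M_def using ne by (intro Max_in) auto
  then obtain s where s: "s \<in> ?S" "M = \<bar>x s\<bar>" by blast
  have M: "M > 0" using nz le by fastforce
  let ?d = "\<lambda>t. glauber_Pt b k n s t - 1 / real (card ?S)"
  have "\<bar>l\<bar> ^ n * M = \<bar>\<Sum>t\<in>?S. ?d t * x t\<bar>"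
    using zero pow[OF s(1)] s(2)
    by (simp add: left_diff_distrib sum_subtractf abs_mult power_abs flip: sum_divide_distrib)
  also have "\<dots> \<le> (\<Sum>t\<in>?S. \<bar>?d t\<bar> * M)"
    by (rule order_trans[OF sum_abs]) (auto simp: abs_mult intro!: sum_mono mult_left_mono le)
  also have "\<dots> = 2 * tv_dist b k n s * M" unfolding tv_dist_def sum_distrib_right[symmetric] by simp
  also have "\<dots> \<le> exp (-1) * M"
  proof (rule mult_right_mono)
    have "tv_dist b k n s \<le> 1 / (2 * exp 1)" using mix s(1) by (simp only: mixes_by_def)
    then show "2 * tv_dist b k n s \<le> exp (-1)" by (simp add: exp_minus field_simps)
  qed (use M in simp)
  finally show ?thesis using M by simp
qed

text \<open>From \<open>\<bar>l\<bar> ^ n \<le> exp (-1)\<close> follows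
  \<open>\<bar>l\<bar> \<le> exp (-1/n) \<le> n / (n + 1)\<close>, a gap of at least
  \<open>1 / (n + 1)\<close>. For \<open>n = 0\<close> the bound would read
  \<open>1 \<le> exp (-1)\<close>, which is absurd.\<close>

lemma relaxation_time_le:
  assumes mix: "mixes_by b k n" and b: "2 \<le> b" and k: "3 \<le> k"
  shows "lambda_star b k < 1" "relaxation_time b k \<le> real n + 1"
proof -
  let ?L = "{\<bar>l\<bar> | l. is_eigenvalue b k l \<and> l \<noteq> 1}"
  have "?L \<subseteq> abs ` {l. is_eigenvalue b k l}" by blast
  then have fin: "finite ?L" using finite_eigenvalues finite_subset by blast
  have "real b / real (b + 1) \<noteq> 1" by simp
  then have ne: "?L \<noteq> {}" using is_eigenvalue_leaf_difference[OF b k] by blast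
  have "y \<le> real n / (real n + 1)" if "y \<in> ?L" for y
  proof (cases "n = 0")
    case True
    then show ?thesis using eigenvalue_power_le[OF mix] that by force
  next
    case False
    have y0: "0 \<le> y" using that by auto
    have "y ^ n \<le> exp (-1)" using eigenvalue_power_le[OF mix] that by blast
    also have "exp (-1) = exp (- (1 / real n)) ^ n" using False by (simp flip: exp_of_nat_mult)
    finally have "y \<le> exp (- (1 / real n))"
      using y0 False by (simp add: power_mono_iff)
    also have "\<dots> \<le> 1 / (1 + 1 / real n)"
      using exp_ge_add_one_self[of "1 / real n"] 
      by (simp add: exp_minus inverse_eq_divide) (intro divide_left_mono, auto simp: add_pos_nonneg)
    also have "\<dots> = real n / (real n + 1)" using False by (simp add: field_simps)
    finally show ?thesis .
  qed
  then have le: "lambda_star b k \<le> real n / (real n + 1)"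
    unfolding lambda_star_def using fin ne by (subst Max_le_iff) auto
  have "real n / (real n + 1) = 1 - 1 / (real n + 1)" by (simp add: field_simps)
  then have gap: "1 / (real n + 1) \<le> 1 - lambda_star b k" using le by simp
  moreover have "0 < 1 / (real n + 1)" by simp
  ultimately have pos: "0 < 1 - lambda_star b k" by linarith
  then show "lambda_star b k < 1" by simp
  show "relaxation_time b k \<le> real n + 1"
    unfolding relaxation_time_def using gap pos by (simp add: field_simps)
qed

section \<open>The coupling\<close>

lemma measure_bind_pmf_le_integral:
  assumes fin: "finite (set_pmf p)" and le: "\<And>z. z \<in> set_pmf p \<Longrightarrow> measure_pmf.prob (f z) D \<le> g z"
  shows "measure_pmf.prob (bind_pmf p f) D \<le> measure_pmf.expectation p g"
proof -
  have g0: "0 \<le> g z" if "z \<in> set_pmf p" for z using le[OF that] measure_nonneg order_trans by blast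
  have "ennreal (measure_pmf.prob (bind_pmf p f) D) = (\<integral>\<^sup>+z. ennreal (measure_pmf.prob (f z) D) \<partial>p)"
    by (simp flip: measure_pmf.emeasure_eq_measure)
  also have "\<dots> \<le> (\<integral>\<^sup>+z. ennreal (g z) \<partial>p)"
    using le by (intro nn_integral_mono_AE) (auto simp: AE_measure_pmf_iff intro: ennreal_leI)
  also have "\<dots> = ennreal (measure_pmf.expectation p g)"
    using fin g0 by (intro nn_integral_eq_integral integrable_measure_pmf_finite) (auto simp: AE_measure_pmf_iff)
  finally show ?thesis
    using g0 by (subst (asm) ennreal_le_iff) (auto intro!: integral_nonneg_AE simp: AE_measure_pmf_iff)
qed

text \<open>\<open>B\<close> collects the first-stage outcomes written off as failures. Applied at
  every root update, this turns the failure probability of a run into a sum.\<close>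

lemma measure_bind_pmf_le:
  assumes fin: "finite (set_pmf p)" and c: "0 \<le> c"
    and le: "\<And>z. z \<in> set_pmf p \<Longrightarrow> z \<notin> B \<Longrightarrow> measure_pmf.prob (f z) D \<le> c"
  shows "measure_pmf.prob (bind_pmf p f) D \<le> measure_pmf.prob p B + c"
proof -
  have "measure_pmf.prob (bind_pmf p f) D \<le> measure_pmf.expectation p (\<lambda>z. indicator B z + c)"
  proof (rule measure_bind_pmf_le_integral[OF fin])
    fix z assume "z \<in> set_pmf p"
    then show "measure_pmf.prob (f z) D \<le> indicator B z + c"
      using le[of z] c by (cases "z \<in> B") (auto intro: add_increasing2)
  qed
  also have "\<dots> = measure_pmf.prob p B + c"
    using fin by (subst Bochner_Integration.integral_add) (auto intro: integrable_measure_pmf_finite)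
  finally show ?thesis .
qed

text \<open>Given that \<open>u\<close> falls into \<open>A\<close> it is uniform on
  \<open>A\<close>; otherwise a fresh uniform element of \<open>A\<close> replaces it.\<close>

lemma resample_outside:
  assumes U: "finite U" "A \<subseteq> U" and A: "A \<noteq> {}"
  shows "bind_pmf (pmf_of_set U) (\<lambda>u. map_pmf (\<lambda>a. if u \<in> A then u else a) (pmf_of_set A)) = pmf_of_set A"
proof (rule pmf_eqI)
  fix c
  have fA: "finite A" and U0: "U \<noteq> {}" using U A finite_subset by auto
  have pos: "real (card A) > 0" "real (card U) > 0" "card A \<le> card U" using fA A U U0 by (auto simp: card_gt_0_iff card_mono)
  have "(\<Sum>u\<in>U. pmf (map_pmf (\<lambda>a. if u \<in> A then u else a) (pmf_of_set A)) c) =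
      (\<Sum>u\<in>A. pmf (map_pmf (\<lambda>a. if u \<in> A then u else a) (pmf_of_set A)) c) +
      (\<Sum>u\<in>U - A. pmf (map_pmf (\<lambda>a. if u \<in> A then u else a) (pmf_of_set A)) c)"
    using sum.subset_diff[OF U(2,1)] by (simp only: add.commute)
  also have "(\<Sum>u\<in>A. pmf (map_pmf (\<lambda>a. if u \<in> A then u else a) (pmf_of_set A)) c) = (\<Sum>u\<in>A. if u = c then 1 else 0)"
    by (intro sum.cong refl) (simp add: indicator_def)
  also have "\<dots> = indicator A c" using fA by (simp add: indicator_def)
  also have "(\<Sum>u\<in>U - A. pmf (map_pmf (\<lambda>a. if u \<in> A then u else a) (pmf_of_set A)) c) =
      (\<Sum>u\<in>U - A. indicator A c / real (card A))"
    using A fA by (intro sum.cong refl) (auto simp: map_pmf_ident pmf_of_set)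
  also have "\<dots> = (real (card U) - real (card A)) * (indicator A c / real (card A))"
    using U fA pos by (simp add: card_Diff_subset of_nat_diff)
  finally show "pmf (bind_pmf (pmf_of_set U) (\<lambda>u. map_pmf (\<lambda>a. if u \<in> A then u else a) (pmf_of_set A))) c = pmf (pmf_of_set A) c"
    using U U0 A fA pos by (simp add: pmf_bind_pmf_of_set field_simps)
qed

text \<open>Not an optimal coupling, but both marginals are uniform and the coordinates coincide as soon as
  \<open>u\<close> lies in both sets.\<close>

definition couple_sets :: "'a set \<Rightarrow> 'a set \<Rightarrow> ('a \<times> 'a) pmf" where
  "couple_sets A B = do {u \<leftarrow> pmf_of_set (A \<union> B); a \<leftarrow> pmf_of_set A; a' \<leftarrow> pmf_of_set B;
     return_pmf (if u \<in> A then u else a, if u \<in> B then u else a')}"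

context
  fixes A B :: "'a set"
  assumes AB: "finite A" "finite B" "A \<noteq> {}" "B \<noteq> {}"
begin

lemma map_fst_couple_sets: "map_pmf fst (couple_sets A B) = pmf_of_set A"
  using AB resample_outside[of "A \<union> B" A] unfolding couple_sets_def map_pmf_def
  by (simp add: bind_assoc_pmf bind_return_pmf)

lemma map_snd_couple_sets: "map_pmf snd (couple_sets A B) = pmf_of_set B"
  using AB resample_outside[of "A \<union> B" B] unfolding couple_sets_def map_pmf_def
  by (simp add: bind_assoc_pmf bind_return_pmf)

lemma finite_set_couple_sets: "finite (set_pmf (couple_sets A B))"
  using AB by (simp add: couple_sets_def set_pmf_of_set)

lemma couple_sets_differ:
  "measure_pmf.prob (couple_sets A B) {z. fst z \<noteq> snd z} \<le>
     real (card ((A - B) \<union> (B - A))) / real (card (A \<union> B))"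
proof -
  have "measure_pmf.prob (couple_sets A B) {z. fst z \<noteq> snd z} \<le>
     measure_pmf.prob (pmf_of_set (A \<union> B)) ((A - B) \<union> (B - A)) + 0"
    unfolding couple_sets_def
  proof (rule measure_bind_pmf_le)
    fix u assume "u \<in> set_pmf (pmf_of_set (A \<union> B))" "u \<notin> (A - B) \<union> (B - A)"
    then have "u \<in> A" "u \<in> B" using AB by (auto simp: set_pmf_of_set)
    then show "measure_pmf.prob (pmf_of_set A \<bind> (\<lambda>a. pmf_of_set B \<bind> (\<lambda>a'. return_pmf (if u \<in> A then u else a, if u \<in> B then u else a'))))
        {z. fst z \<noteq> snd z} \<le> 0"
      by simp
  qed (use AB in \<open>simp_all add: set_pmf_of_set\<close>)
  also have "\<dots> = real (card ((A \<union> B) \<inter> ((A - B) \<union> (B - A)))) / real (card (A \<union> B))"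
    using AB by (simp add: measure_pmf_of_set)
  also have "(A \<union> B) \<inter> ((A - B) \<union> (B - A)) = (A - B) \<union> (B - A)" by blast
  finally show ?thesis .
qed

end

text \<open>Leaf updates are driven by an element of \<^term>\<open>{1..k-1}\<close>, to be used unless it is the colour
  of the root, in which case the leaf gets colour \<^term>\<open>k\<close>.\<close>

definition leaf_colour :: "nat \<Rightarrow> nat \<Rightarrow> nat \<Rightarrow> nat" where
  "leaf_colour k r c = (if c = r then k else c)"

text \<open>\<open>leaf_colour k r\<close> is a bijection: it trades \<open>r\<close> for the colour
  \<open>k\<close>, which is never drawn, and is the identity on the draws when
  \<open>r = k\<close>.\<close>

lemma leaf_colour_uniform:
  assumes "r \<in> {1..k}" "2 \<le> k"
  shows "map_pmf (leaf_colour k r) (pmf_of_set {1..k-1}) = pmf_of_set ({1..k} - {r})"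
proof -
  have "leaf_colour k r ` {1..k-1} = {1..k} - {r}"
  proof (intro equalityI subsetI)
    fix c assume c: "c \<in> {1..k} - {r}"
    show "c \<in> leaf_colour k r ` {1..k-1}"
    proof (cases "c = k")
      case True
      then have "c = leaf_colour k r r" "r \<in> {1..k-1}" using c assms by (auto simp: leaf_colour_def)
      then show ?thesis by blast
    next
      case False
      then have "c = leaf_colour k r c" "c \<in> {1..k-1}" using c assms by (auto simp: leaf_colour_def)
      then show ?thesis by blast
    qed
  qed (use assms in \<open>auto simp: leaf_colour_def split: if_splits\<close>)
  moreover have "inj_on (leaf_colour k r) {1..k-1}"
    using assms by (auto simp: inj_on_def leaf_colour_def)
  ultimately show ?thesis using assms by (subst map_pmf_of_set_inj) auto
qed

text \<open>A colour is drawn even if the vertex is the root, where it is ignored; this keeps the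
  moves identically distributed. The new colour of the root is not part of the move and stays random
  once the moves are fixed.\<close>

definition moves :: "nat \<Rightarrow> nat \<Rightarrow> (nat \<times> nat) pmf" where
  "moves b k = pair_pmf (pmf_of_set {0..b}) (pmf_of_set {1..k-1})"

fun apply_move :: "nat \<Rightarrow> nat \<Rightarrow> nat \<times> nat \<Rightarrow> (nat \<Rightarrow> nat) \<Rightarrow> (nat \<Rightarrow> nat) pmf" where
  "apply_move b k (v, c) s = (if v = 0 then map_pmf (\<lambda>a. s(0 := a)) (pmf_of_set (avail b k s 0))
     else return_pmf (s(v := leaf_colour k (s 0) c)))"

fun couple_move :: "nat \<Rightarrow> nat \<Rightarrow> nat \<times> nat \<Rightarrow> (nat \<Rightarrow> nat) \<times> (nat \<Rightarrow> nat) \<Rightarrow> ((nat \<Rightarrow> nat) \<times> (nat \<Rightarrow> nat)) pmf" where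
  "couple_move b k (v, c) (x, y) =
     (if v = 0 then map_pmf (\<lambda>(a, a'). (x(0 := a), y(0 := a'))) (couple_sets (avail b k x 0) (avail b k y 0))
      else return_pmf (x(v := leaf_colour k (x 0) c), y(v := leaf_colour k (y 0) c)))"

primrec run :: "('m \<Rightarrow> 's \<Rightarrow> 's pmf) \<Rightarrow> 'm list \<Rightarrow> 's \<Rightarrow> 's pmf" where
  "run K [] s = return_pmf s"
| "run K (m # ms) s = bind_pmf (K m s) (run K ms)"

lemma set_moves: "2 \<le> k \<Longrightarrow> set_pmf (moves b k) = {0..b} \<times> {1..k-1}"
  by (simp add: moves_def set_pmf_of_set)

lemma moves_apply_move:
  assumes s: "s \<in> colorings b k" and k: "2 \<le> k"
  shows "bind_pmf (moves b k) (\<lambda>m. apply_move b k m s) = heat_bath b k s"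
proof -
  have "bind_pmf (moves b k) (\<lambda>m. apply_move b k m s) =
      bind_pmf (pmf_of_set {0..b}) (\<lambda>v. bind_pmf (pmf_of_set {1..k-1}) (\<lambda>c. apply_move b k (v, c) s))"
    by (simp add: moves_def pair_pmf_def bind_assoc_pmf bind_return_pmf)
  also have "\<dots> = heat_bath b k s"
    unfolding heat_bath_def
  proof (rule bind_pmf_cong[OF refl])
    fix v assume "v \<in> set_pmf (pmf_of_set {0..b})"
    then have v: "v \<le> b" by (simp add: set_pmf_of_set)
    show "bind_pmf (pmf_of_set {1..k-1}) (\<lambda>c. apply_move b k (v, c) s) =
        map_pmf (\<lambda>c. s(v := c)) (pmf_of_set (avail b k s v))"
    proof (cases "v = 0")
      case False
      have "s 0 \<in> {1..k}" using s by (simp add: colorings_iff)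
      then have "map_pmf (\<lambda>c. s(v := c)) (map_pmf (leaf_colour k (s 0)) (pmf_of_set {1..k-1})) =
          map_pmf (\<lambda>c. s(v := c)) (pmf_of_set (avail b k s v))"
        using leaf_colour_uniform[of "s 0" k] k v False by (simp add: avail_leaf)
      then show ?thesis using False by (simp add: map_pmf_def bind_assoc_pmf bind_return_pmf)
    qed simp
  qed
  finally show ?thesis .
qed

lemma set_apply_move:
  assumes "s \<in> colorings b k" "m \<in> {0..b} \<times> {1..k-1}"
  shows "set_pmf (apply_move b k m s) \<subseteq> colorings b k"
proof (cases m)
  case (Pair v c)
  show ?thesis
  proof (cases "v = 0")
    case True
    then show ?thesis using assms Pair avail_nonempty[OF assms(1), of 0]
      by (auto simp: set_pmf_of_set intro: recolour_in_colorings)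
  next
    case False
    then have v: "v \<in> {1..b}" using assms Pair by auto
    have "leaf_colour k (s 0) c \<in> avail b k s v"
      using assms Pair v by (auto simp: avail_leaf leaf_colour_def colorings_iff)
    then show ?thesis using recolour_in_colorings[OF assms(1), of v] v Pair False by simp
  qed
qed

text \<open>Drawing all moves beforehand is the same as drawing them step by step: the later moves
  are independent of the first transition, so the two draws can be exchanged.\<close>

lemma pmf_run_random_moves:
  assumes "s \<in> colorings b k" "t \<in> colorings b k" "2 \<le> k"
  shows "pmf (bind_pmf (replicate_pmf n (moves b k)) (\<lambda>ms. run (apply_move b k) ms s)) t = glauber_Pt b k n s t"
  using assms(1)
proof (induction n arbitrary: s)
  case 0
  then show ?case by (auto simp: bind_return_pmf)
next
  case (Suc n)
  let ?R = "\<lambda>s. bind_pmf (replicate_pmf n (moves b k)) (\<lambda>ms. run (apply_move b k) ms s)"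
  have "bind_pmf (replicate_pmf (Suc n) (moves b k)) (\<lambda>ms. run (apply_move b k) ms s) =
      bind_pmf (moves b k) (\<lambda>m. bind_pmf (replicate_pmf n (moves b k)) (\<lambda>ms. bind_pmf (apply_move b k m s) (run (apply_move b k) ms)))"
    by (simp add: bind_assoc_pmf bind_return_pmf)
  also have "\<dots> = bind_pmf (moves b k) (\<lambda>m. bind_pmf (apply_move b k m s) ?R)"
    by (subst bind_commute_pmf) rule
  also have "\<dots> = bind_pmf (heat_bath b k s) ?R"
    by (simp add: bind_assoc_pmf flip: moves_apply_move[OF Suc.prems assms(3)])
  finally have "pmf (bind_pmf (replicate_pmf (Suc n) (moves b k)) (\<lambda>ms. run (apply_move b k) ms s)) t =
      (\<integral>r. pmf (?R r) t \<partial>heat_bath b k s)"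
    by (simp add: pmf_bind)
  also have "\<dots> = (\<Sum>r\<in>colorings b k. pmf (?R r) t * pmf (heat_bath b k s) r)"
    using set_heat_bath[OF Suc.prems] by (intro integral_measure_pmf_real) auto
  also have "\<dots> = (\<Sum>r\<in>colorings b k. glauber_P b k s r * glauber_Pt b k n r t)"
    using Suc by (intro sum.cong refl) (simp add: pmf_heat_bath)
  also have "\<dots> = glauber_Pt b k (Suc n) s t"
    using glauber_Pt_Suc[OF Suc.prems assms(2)] by simp
  finally show ?case .
qed

lemma map_couple_move:
  assumes "x \<in> colorings b k" "y \<in> colorings b k"
  shows "map_pmf fst (couple_move b k m (x, y)) = apply_move b k m x"
    and "map_pmf snd (couple_move b k m (x, y)) = apply_move b k m y"
proof -
  obtain v c where m: "m = (v, c)" by (cases m)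
  let ?A = "avail b k x 0" and ?B = "avail b k y 0"
  note ne = avail_nonempty[OF assms(1), of 0] avail_nonempty[OF assms(2), of 0]
  have "map_pmf fst (map_pmf (\<lambda>(a, a'). (x(0 := a), y(0 := a'))) (couple_sets ?A ?B)) =
      map_pmf (\<lambda>a. x(0 := a)) (map_pmf fst (couple_sets ?A ?B))"
    by (simp add: pmf.map_comp o_def case_prod_beta)
  then show "map_pmf fst (couple_move b k m (x, y)) = apply_move b k m x"
    using ne by (simp add: m map_fst_couple_sets)
  have "map_pmf snd (map_pmf (\<lambda>(a, a'). (x(0 := a), y(0 := a'))) (couple_sets ?A ?B)) =
      map_pmf (\<lambda>a. y(0 := a)) (map_pmf snd (couple_sets ?A ?B))"
    by (simp add: pmf.map_comp o_def case_prod_beta)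
  then show "map_pmf snd (couple_move b k m (x, y)) = apply_move b k m y"
    using ne by (simp add: m map_snd_couple_sets)
qed

lemma set_couple_move:
  assumes "x \<in> colorings b k" "y \<in> colorings b k" "m \<in> {0..b} \<times> {1..k-1}"
  shows "set_pmf (couple_move b k m (x, y)) \<subseteq> colorings b k \<times> colorings b k"
proof
  fix z assume z: "z \<in> set_pmf (couple_move b k m (x, y))"
  have "fst z \<in> set_pmf (apply_move b k m x)" "snd z \<in> set_pmf (apply_move b k m y)"
    using z map_couple_move[OF assms(1,2), of m, symmetric] by auto
  then show "z \<in> colorings b k \<times> colorings b k"
    using set_apply_move assms by (metis mem_Times_iff subsetD)
qed

text \<open>The marginals are right for each fixed list of moves, not merely on average, so failure
  can be bounded list by list before the moves are averaged.\<close>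

lemma map_run_couple_move:
  assumes "x \<in> colorings b k" "y \<in> colorings b k" "set ms \<subseteq> {0..b} \<times> {1..k-1}"
  shows "map_pmf fst (run (couple_move b k) ms (x, y)) = run (apply_move b k) ms x"
    and "map_pmf snd (run (couple_move b k) ms (x, y)) = run (apply_move b k) ms y"
  using assms
proof (induction ms arbitrary: x y)
  case (Cons m ms)
  {
    case 1
    have "map_pmf fst (run (couple_move b k) (m # ms) (x, y)) =
        bind_pmf (couple_move b k m (x, y)) (\<lambda>z. run (apply_move b k) ms (fst z))"
      unfolding run.simps map_bind_pmf
      using set_couple_move[of x b k y m] 1 Cons.IH(1) by (intro bind_pmf_cong refl) force
    also have "\<dots> = bind_pmf (map_pmf fst (couple_move b k m (x, y))) (run (apply_move b k) ms)"
      by (simp add: bind_map_pmf)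
    finally show ?case using 1 by (simp add: map_couple_move)
  next
    case 2
    have "map_pmf snd (run (couple_move b k) (m # ms) (x, y)) =
        bind_pmf (couple_move b k m (x, y)) (\<lambda>z. run (apply_move b k) ms (snd z))"
      unfolding run.simps map_bind_pmf
      using set_couple_move[of x b k y m] 2 Cons.IH(2) by (intro bind_pmf_cong refl) force
    also have "\<dots> = bind_pmf (map_pmf snd (couple_move b k m (x, y))) (run (apply_move b k) ms)"
      by (simp add: bind_map_pmf)
    finally show ?case using 2 by (simp add: map_couple_move)
  }
qed auto

section \<open>Coalescence along a fixed sequence of moves\<close>

definition missing :: "nat \<Rightarrow> nat \<Rightarrow> (nat \<Rightarrow> nat) \<Rightarrow> nat" where
  "missing b k lc = card ({1..k-1} - lc ` {1..b})"

definition root_moves :: "(nat \<times> nat) list \<Rightarrow> nat" where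
  "root_moves ms = length (filter (\<lambda>m. fst m = 0) ms)"

text \<open>Up to a factor, a union bound for the event that some root move leaves the roots
  different. The summand 1 keeps a term meaningful when the choices exhaust all of
  \<open>{1..k-1}\<close>.\<close>

primrec root_cost :: "nat \<Rightarrow> nat \<Rightarrow> (nat \<times> nat) list \<Rightarrow> (nat \<Rightarrow> nat) \<Rightarrow> real" where
  "root_cost b k [] lc = 0"
| "root_cost b k (m # ms) lc =
     (if fst m = 0 then 1 / (real (missing b k lc) + 1) + root_cost b k ms lc
      else root_cost b k ms (lc(fst m := snd m)))"

lemma root_cost_nonneg: "0 \<le> root_cost b k ms lc"
  by (induction ms arbitrary: lc) auto

text \<open>Here \<open>lc\<close> records the most recent choice at each leaf, \<open>U\<close> is the set of leaves updated so far, and \<open>R\<close>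
  contains \<^term>\<open>k\<close> and all root colours so far. Before its first update the entry of \<open>lc\<close> at a leaf is
  arbitrary, which later allows to start \<open>lc\<close> in its stationary distribution.\<close>

definition traces :: "nat \<Rightarrow> nat \<Rightarrow> nat set \<Rightarrow> (nat \<Rightarrow> nat) \<Rightarrow> nat set \<Rightarrow> (nat \<Rightarrow> nat) \<Rightarrow> bool" where
  "traces b k U lc R s \<longleftrightarrow> s \<in> colorings b k \<and> s 0 \<in> R \<and> (\<forall>v\<in>U. s v = lc v \<or> s v = k \<and> lc v \<in> R)"

text \<open>A root move adds at most two colours to \<open>R\<close> and leaves one root move fewer
  to come. Hence \<open>card R + 2 * root_moves ms\<close> never increases, and \<rho> bounds
  \<open>card R\<close> throughout the run.\<close>

definition pair_inv :: "nat \<Rightarrow> nat \<Rightarrow> real \<Rightarrow> nat set \<Rightarrow> (nat \<Rightarrow> nat) \<Rightarrow> nat set \<Rightarrow> (nat \<times> nat) list \<Rightarrow>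
    (nat \<Rightarrow> nat) \<Rightarrow> (nat \<Rightarrow> nat) \<Rightarrow> bool" where
  "pair_inv b k \<rho> U lc R ms x y \<longleftrightarrow> traces b k U lc R x \<and> traces b k U lc R y \<and> finite R \<and> k \<in> R \<and>
     real (card R) + 2 * real (root_moves ms) \<le> \<rho> \<and> U \<subseteq> {1..b} \<and> set ms \<subseteq> {0..b} \<times> {1..k-1}"

lemma pair_inv_colorings:
  "pair_inv b k \<rho> U lc R ms x y \<Longrightarrow> x \<in> colorings b k \<and> y \<in> colorings b k"
  by (simp add: pair_inv_def traces_def)

lemma avail_of_traces:
  assumes "traces b k {1..b} lc R s"
  shows "{1..k-1} - lc ` {1..b} \<subseteq> avail b k s 0"
proof
  fix c assume c: "c \<in> {1..k-1} - lc ` {1..b}"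
  have "c \<noteq> s v" if "v \<in> {1..b}" for v
  proof -
    have "s v = lc v \<or> s v = k" using assms that by (auto simp: traces_def)
    moreover have "c \<noteq> lc v" "c \<noteq> k" using c that by auto
    ultimately show ?thesis by metis
  qed
  then have "c \<notin> s ` {1..b}" by blast
  then show "c \<in> avail b k s 0" using c by (auto simp: avail_root)
qed

text \<open>A colour outside \<open>R\<close> that blocks the root of \<open>y\<close> is not
  \<open>k\<close>, so it is the latest choice at some leaf; being outside \<open>R\<close>, that
  choice is also shown by \<open>x\<close> there.\<close>

lemma avail_diff_of_traces:
  assumes x: "traces b k {1..b} lc R x" and y: "traces b k {1..b} lc R y" and k: "k \<in> R"
  shows "avail b k x 0 - avail b k y 0 \<subseteq> R"
proof (rule subsetI, rule ccontr)
  fix c assume c: "c \<in> avail b k x 0 - avail b k y 0" "c \<notin> R"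
  then obtain v where v: "v \<in> {1..b}" "c = y v" by (auto simp: avail_root)
  then have "y v = lc v" using y k c by (auto simp: traces_def)
  then have "x v = c" using x v c by (auto simp: traces_def)
  moreover have "c \<notin> x ` {1..b}" using c by (simp add: avail_root)
  ultimately show False using v(1) by blast
qed

lemma couple_move_root_differ:
  assumes inv: "pair_inv b k \<rho> {1..b} lc R ((0, c) # ms) x y"
  shows "measure_pmf.prob (couple_move b k (0, c) (x, y)) {z. fst z 0 \<noteq> snd z 0}
    \<le> 2 * \<rho> * (1 / (real (missing b k lc) + 1))"
proof -
  let ?A = "avail b k x 0" and ?B = "avail b k y 0" and ?m = "real (missing b k lc)"
  have x: "traces b k {1..b} lc R x" and y: "traces b k {1..b} lc R y" and R: "finite R" "k \<in> R" "real (card R) \<le> \<rho>"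
    using inv by (auto simp: pair_inv_def)
  have col: "x \<in> colorings b k" "y \<in> colorings b k" using pair_inv_colorings[OF inv] by auto
  note ne = avail_nonempty[OF col(1), of 0, simplified] avail_nonempty[OF col(2), of 0, simplified]
  have diff: "(?A - ?B) \<union> (?B - ?A) \<subseteq> R"
    using avail_diff_of_traces[OF x y R(2)] avail_diff_of_traces[OF y x R(2)] by blast
  have "missing b k lc \<le> card (?A \<union> ?B)"
    unfolding missing_def using avail_of_traces[OF x] by (intro card_mono) auto
  moreover have "1 \<le> card (?A \<union> ?B)" using ne by (simp add: Suc_le_eq card_gt_0_iff)
  \<comment> \<open>The cardinality is at least \<open>missing\<close> and at least 1, hence at
    least half their sum: this is the factor 2 in the bound.\<close>
  ultimately have "missing b k lc + 1 \<le> 2 * card (?A \<union> ?B)" by linarith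
  then have big: "(?m + 1) / 2 \<le> real (card (?A \<union> ?B))" by (simp add: field_simps flip: of_nat_Suc)
  have "measure_pmf.prob (couple_move b k (0, c) (x, y)) {z. fst z 0 \<noteq> snd z 0} =
      measure_pmf.prob (couple_sets ?A ?B) {z. fst z \<noteq> snd z}"
    by (simp add: measure_map_pmf vimage_def case_prod_beta)
  also have "\<dots> \<le> real (card ((?A - ?B) \<union> (?B - ?A))) / real (card (?A \<union> ?B))"
    using ne by (intro couple_sets_differ) auto
  also have "\<dots> \<le> \<rho> / ((?m + 1) / 2)"
    using big R card_mono[OF R(1) diff] by (intro frac_le) auto
  finally show ?thesis by (simp add: mult.commute)
qed

lemma finite_set_couple_move:
  assumes "x \<in> colorings b k" "y \<in> colorings b k"
  shows "finite (set_pmf (couple_move b k m (x, y)))"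
  using avail_nonempty[OF assms(1), of 0] avail_nonempty[OF assms(2), of 0]
  by (cases m) (auto simp: finite_set_couple_sets)

text \<open>The updated leaf shows its new choice \<open>c\<close>, or shows \<open>k\<close>
  because \<open>c\<close> is the current root colour, which lies in \<open>R\<close>.\<close>

lemma pair_inv_leaf:
  assumes inv: "pair_inv b k \<rho> U lc R ((v, c) # ms) x y" and v: "v \<noteq> 0"
  shows "pair_inv b k \<rho> (insert v U) (lc(v := c)) R ms
    (x(v := leaf_colour k (x 0) c)) (y(v := leaf_colour k (y 0) c))"
proof -
  have vc: "v \<in> {1..b}" "(v, c) \<in> {0..b} \<times> {1..k-1}" using inv v by (auto simp: pair_inv_def)
  have "traces b k (insert v U) (lc(v := c)) R (s(v := leaf_colour k (s 0) c))" if "traces b k U lc R s" for s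
    using that set_apply_move[of s b k "(v, c)"] vc v by (auto simp: traces_def leaf_colour_def)
  then show ?thesis using inv vc v by (auto simp: pair_inv_def root_moves_def)
qed

lemma pair_inv_root:
  assumes inv: "pair_inv b k \<rho> U lc R ((0, c) # ms) x y"
    and z: "z \<in> set_pmf (couple_move b k (0, c) (x, y))"
  shows "\<exists>R'. pair_inv b k \<rho> U lc R' ms (fst z) (snd z)"
    and "\<forall>v. v \<noteq> 0 \<longrightarrow> fst z v = x v \<and> snd z v = y v"
proof -
  show same: "\<forall>v. v \<noteq> 0 \<longrightarrow> fst z v = x v \<and> snd z v = y v" using z by auto
  have "set ((0, c) # ms) \<subseteq> {0..b} \<times> {1..k-1}" using inv by (simp add: pair_inv_def)
  then have "z \<in> colorings b k \<times> colorings b k"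
    using set_couple_move[of x b k y "(0, c)"] pair_inv_colorings[OF inv] z by auto
  moreover define R' where "R' = insert (fst z 0) (insert (snd z 0) R)"
  moreover have "card R' \<le> card R + 2"
    unfolding R'_def by (intro order_trans[OF card_insert_le_m1]) (auto simp: card_insert_if inv[unfolded pair_inv_def])
  moreover have "v \<noteq> 0" if "v \<in> U" for v using inv that by (auto simp: pair_inv_def)
  ultimately have "pair_inv b k \<rho> U lc R' ms (fst z) (snd z)"
    using inv same unfolding pair_inv_def traces_def by (auto simp: root_moves_def)
  then show "\<exists>R'. pair_inv b k \<rho> U lc R' ms (fst z) (snd z)" ..
qed

text \<open>\<open>W\<close> holds vertices already known to agree. While the roots agree, an
  updated leaf gets the same colour in both copies and joins \<open>W\<close>; only a root move can
  spoil this, at the price of its term in \<open>root_cost\<close>.\<close>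

lemma roots_agree_bound:
  assumes "pair_inv b k \<rho> {1..b} lc R ms x y" "x 0 = y 0" "\<forall>v\<in>W. x v = y v" "{1..b} \<subseteq> W \<union> fst ` set ms"
  shows "measure_pmf.prob (run (couple_move b k) ms (x, y)) {z. fst z \<noteq> snd z} \<le> 2 * \<rho> * root_cost b k ms lc"
  using assms
proof (induction ms arbitrary: lc R x y W)
  case Nil
  have "x v = y v" for v
  proof (cases "v \<in> {1..b}")
    case True
    then show ?thesis using Nil by auto
  next
    case False
    then have "v = 0 \<or> v > b" by auto
    then show ?thesis using Nil(2) pair_inv_colorings[OF Nil(1)] by (auto simp: colorings_iff)
  qed
  then show ?case by auto
next
  case (Cons m ms)
  obtain v c where m: "m = (v, c)" by (cases m)
  have \<rho>: "0 \<le> \<rho>" using Cons.prems(1) by (auto simp: pair_inv_def)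
  note inv = Cons.prems(1)[unfolded m]
  show ?case
  proof (cases "v = 0")
    case True
    have "measure_pmf.prob (run (couple_move b k) (m # ms) (x, y)) {z. fst z \<noteq> snd z} \<le>
       measure_pmf.prob (couple_move b k m (x, y)) {z. fst z 0 \<noteq> snd z 0} + 2 * \<rho> * root_cost b k ms lc"
      unfolding run.simps
    proof (rule measure_bind_pmf_le)
      fix z assume z: "z \<in> set_pmf (couple_move b k m (x, y))" "z \<notin> {z. fst z 0 \<noteq> snd z 0}"
      obtain R' where R': "pair_inv b k \<rho> {1..b} lc R' ms (fst z) (snd z)"
        using pair_inv_root(1)[of b k \<rho> _ lc R c ms x y z] inv z True m by auto
      have "\<forall>v\<in>W - {0}. fst z v = snd z v"
        using pair_inv_root(2)[of b k \<rho> _ lc R c ms x y z] inv z True m Cons.prems(3) by auto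
      moreover have "{1..b} \<subseteq> W - {0} \<union> fst ` set ms" using Cons.prems(4) m True by fastforce
      ultimately show "measure_pmf.prob (run (couple_move b k) ms z) {z. fst z \<noteq> snd z} \<le> 2 * \<rho> * root_cost b k ms lc"
        using Cons.IH[OF R', of "W - {0}"] z by simp
    qed (use \<rho> finite_set_couple_move pair_inv_colorings[OF inv] root_cost_nonneg in auto)
    also have "\<dots> \<le> 2 * \<rho> * root_cost b k (m # ms) lc"
      using couple_move_root_differ[of b k \<rho> lc R c ms x y] inv True m by (simp add: distrib_left)
    finally show ?thesis .
  next
    case False
    have "insert v {1..b} = {1..b}" using inv False by (auto simp: pair_inv_def)
    then have inv': "pair_inv b k \<rho> {1..b} (lc(v := c)) R ms (x(v := leaf_colour k (x 0) c)) (y(v := leaf_colour k (y 0) c))"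
      using pair_inv_leaf[OF inv False] by simp
    have "measure_pmf.prob (run (couple_move b k) (ms) (x(v := leaf_colour k (x 0) c), y(v := leaf_colour k (y 0) c))) {z. fst z \<noteq> snd z}
        \<le> 2 * \<rho> * root_cost b k (ms) (lc(v := c))"
      by (rule Cons.IH[OF inv', of "insert v W"]) (use Cons.prems False m in auto)
    then show ?thesis using False m by (simp add: bind_return_pmf)
  qed
qed

text \<open>The first root move in \<open>ms\<close> is the one that should make the roots equal.
  From then on \<open>roots_agree_bound\<close> applies with no leaf assumed to agree, because
  \<open>ms'\<close> still visits every leaf.\<close>

lemma meet_bound:
  assumes "pair_inv b k \<rho> {1..b} lc R (ms @ ms') x y" "0 \<in> fst ` set ms" "{1..b} \<subseteq> fst ` set ms'"
  shows "measure_pmf.prob (run (couple_move b k) (ms @ ms') (x, y)) {z. fst z \<noteq> snd z}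
    \<le> 2 * \<rho> * root_cost b k (ms @ ms') lc"
  using assms
proof (induction ms arbitrary: lc R x y)
  case (Cons m ms)
  obtain v c where m: "m = (v, c)" by (cases m)
  have \<rho>: "0 \<le> \<rho>" using Cons.prems(1) by (auto simp: pair_inv_def)
  note inv = Cons.prems(1)[unfolded m append_Cons]
  show ?case
  proof (cases "v = 0")
    case True
    have "measure_pmf.prob (run (couple_move b k) (m # (ms @ ms')) (x, y)) {z. fst z \<noteq> snd z} \<le>
       measure_pmf.prob (couple_move b k m (x, y)) {z. fst z 0 \<noteq> snd z 0} + 2 * \<rho> * root_cost b k (ms @ ms') lc"
      unfolding run.simps
    proof (rule measure_bind_pmf_le)
      fix z assume z: "z \<in> set_pmf (couple_move b k m (x, y))" "z \<notin> {z. fst z 0 \<noteq> snd z 0}"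
      obtain R' where R': "pair_inv b k \<rho> {1..b} lc R' (ms @ ms') (fst z) (snd z)"
        using pair_inv_root(1)[of b k \<rho> _ lc R c "ms @ ms'" x y z] inv z True m by auto
      then show "measure_pmf.prob (run (couple_move b k) (ms @ ms') z) {z. fst z \<noteq> snd z} \<le> 2 * \<rho> * root_cost b k (ms @ ms') lc"
        using roots_agree_bound[OF R', of "{}"] z Cons.prems(3) by auto
    qed (use \<rho> finite_set_couple_move pair_inv_colorings[OF inv] root_cost_nonneg in auto)
    also have "\<dots> \<le> 2 * \<rho> * root_cost b k (m # (ms @ ms')) lc"
      using couple_move_root_differ[of b k \<rho> lc R c "ms @ ms'" x y] inv True m by (simp add: distrib_left)
    finally show ?thesis by simp
  next
    case False
    have "insert v {1..b} = {1..b}" using inv False by (auto simp: pair_inv_def)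
    then have inv': "pair_inv b k \<rho> {1..b} (lc(v := c)) R (ms @ ms') (x(v := leaf_colour k (x 0) c)) (y(v := leaf_colour k (y 0) c))"
      using pair_inv_leaf[OF inv False] by simp
    have "measure_pmf.prob (run (couple_move b k) (ms @ ms') (x(v := leaf_colour k (x 0) c), y(v := leaf_colour k (y 0) c))) {z. fst z \<noteq> snd z}
        \<le> 2 * \<rho> * root_cost b k (ms @ ms') (lc(v := c))"
      by (rule Cons.IH[OF inv']) (use Cons.prems False m in auto)
    then show ?thesis using False m by (simp add: bind_return_pmf)
  qed
qed simp

lemma coalescence_bound_aux:
  assumes "pair_inv b k \<rho> U lc R (ms @ ms' @ ms'') x y" "{1..b} \<subseteq> U \<union> fst ` set ms"
    and "0 \<in> fst ` set ms'" "{1..b} \<subseteq> fst ` set ms''"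
  shows "measure_pmf.prob (run (couple_move b k) (ms @ ms' @ ms'') (x, y)) {z. fst z \<noteq> snd z}
    \<le> 2 * \<rho> * root_cost b k (ms @ ms' @ ms'') lc"
  using assms(1,2)
proof (induction ms arbitrary: U lc R x y)
  case Nil
  then have "U = {1..b}" by (auto simp: pair_inv_def)
  then show ?case using meet_bound[of b k \<rho> lc R ms' ms'' x y] Nil assms(3,4) by simp
next
  case (Cons m ms)
  let ?ms = "ms @ ms' @ ms''"
  obtain v c where m: "m = (v, c)" by (cases m)
  have \<rho>: "0 \<le> \<rho>" using Cons.prems(1) by (auto simp: pair_inv_def)
  note inv = Cons.prems(1)[unfolded m append_Cons]
  show ?case
  proof (cases "v = 0")
    case True
    \<comment> \<open>The set of failures is empty: before all leaves have been updated nothing is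
      asked of a root move, and its nonnegative cost is simply given away.\<close>
    have "measure_pmf.prob (run (couple_move b k) (m # ?ms) (x, y)) {z. fst z \<noteq> snd z} \<le>
       measure_pmf.prob (couple_move b k m (x, y)) {} + 2 * \<rho> * root_cost b k ?ms lc"
      unfolding run.simps
    proof (rule measure_bind_pmf_le)
      fix z assume z: "z \<in> set_pmf (couple_move b k m (x, y))"
      obtain R' where R': "pair_inv b k \<rho> U lc R' ?ms (fst z) (snd z)"
        using pair_inv_root(1)[of b k \<rho> _ lc R c ?ms x y z] inv z True m by auto
      have "{1..b} \<subseteq> U \<union> fst ` set ms" using Cons.prems(2) True m by auto
      then show "measure_pmf.prob (run (couple_move b k) ?ms z) {z. fst z \<noteq> snd z} \<le> 2 * \<rho> * root_cost b k ?ms lc"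
        using Cons.IH[OF R'] by simp
    qed (use \<rho> finite_set_couple_move pair_inv_colorings[OF inv] root_cost_nonneg in auto)
    also have "\<dots> \<le> 2 * \<rho> * root_cost b k (m # ?ms) lc"
      using True m \<rho> by (simp add: distrib_left)
    finally show ?thesis by simp
  next
    case False
    have "measure_pmf.prob (run (couple_move b k) (ms @ ms' @ ms'') (x(v := leaf_colour k (x 0) c), y(v := leaf_colour k (y 0) c))) {z. fst z \<noteq> snd z}
        \<le> 2 * \<rho> * root_cost b k (ms @ ms' @ ms'') (lc(v := c))"
      by (rule Cons.IH[OF pair_inv_leaf[OF inv False]]) (use Cons.prems False m in auto)
    then show ?thesis using False m by (simp add: bind_return_pmf)
  qed
qed

definition covers :: "nat \<Rightarrow> (nat \<times> nat) list \<Rightarrow> bool" where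
  "covers b ms \<longleftrightarrow> {0..b} \<subseteq> fst ` set ms"

lemma coalescence_bound:
  assumes "x \<in> colorings b k" "y \<in> colorings b k"
    and "covers b ms" "covers b ms'" "covers b ms''"
    and ms: "set (ms @ ms' @ ms'') \<subseteq> {0..b} \<times> {1..k-1}"
    and L: "real (root_moves (ms @ ms' @ ms'')) \<le> L"
  shows "measure_pmf.prob (run (couple_move b k) (ms @ ms' @ ms'') (x, y)) {z. fst z \<noteq> snd z}
    \<le> 2 * (3 + 2 * L) * root_cost b k (ms @ ms' @ ms'') lc"
proof (rule coalescence_bound_aux)
  \<comment> \<open>With no leaf marked as updated, the condition on \<open>lc\<close> is vacuous,
    so \<open>lc\<close> is free. The three initial colours and two more per root move give
    \<open>3 + 2 * L\<close>.\<close>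
  have "card {k, x 0, y 0} \<le> 3" by (simp add: card_insert_if)
  then show "pair_inv b k (3 + 2 * L) {} lc {k, x 0, y 0} (ms @ ms' @ ms'') x y"
    using assms by (auto simp: pair_inv_def traces_def)
qed (use assms in \<open>auto simp: covers_def\<close>)

section \<open>Random sequences of moves\<close>

lemma expectation_bind_finite:
  fixes h :: "'b \<Rightarrow> real"
  assumes "finite (set_pmf p)" "\<And>x. x \<in> set_pmf p \<Longrightarrow> finite (set_pmf (f x))"
  shows "measure_pmf.expectation (bind_pmf p f) h = measure_pmf.expectation p (\<lambda>x. measure_pmf.expectation (f x) h)"
  using assms by (subst pmf_expectation_bind[of "set_pmf p"]) (auto simp: integral_measure_pmf[of "set_pmf p"])

lemma finite_set_replicate_pmf [simp]: "finite (set_pmf p) \<Longrightarrow> finite (set_pmf (replicate_pmf n p))"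
  by (induction n) auto

lemma expectation_replicate_pmf_Suc:
  fixes h :: "'a list \<Rightarrow> real"
  assumes "finite (set_pmf p)"
  shows "measure_pmf.expectation (replicate_pmf (Suc n) p) h =
    measure_pmf.expectation p (\<lambda>x. measure_pmf.expectation (replicate_pmf n p) (\<lambda>xs. h (x # xs)))"
  using assms by (simp add: expectation_bind_finite)

lemma finite_set_moves [simp]: "2 \<le> k \<Longrightarrow> finite (set_pmf (moves b k))"
  by (simp add: set_moves)

lemma prob_moves_fst: "measure_pmf.prob (moves b k) {m. fst m \<in> A} = real (card ({0..b} \<inter> A)) / real (b + 1)"
proof -
  have "measure_pmf.prob (moves b k) {m. fst m \<in> A} = measure_pmf.prob (map_pmf fst (moves b k)) A"
    by (simp add: vimage_def)
  also have "\<dots> = measure_pmf.prob (pmf_of_set {0..b}) A"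
    unfolding moves_def map_fst_pair_pmf ..
  finally show ?thesis by (simp add: measure_pmf_of_set)
qed

lemma prob_replicate_pmf_subset_le:
  assumes "finite (set_pmf p)"
  shows "measure_pmf.prob (replicate_pmf n p) {xs. set xs \<subseteq> B} \<le> measure_pmf.prob p B ^ n"
proof (induction n)
  case (Suc n)
  have "measure_pmf.prob (replicate_pmf (Suc n) p) {xs. set xs \<subseteq> B} \<le>
      measure_pmf.expectation p (\<lambda>x. indicator B x * measure_pmf.prob p B ^ n)"
    unfolding replicate_pmf.simps
  proof (rule measure_bind_pmf_le_integral[OF assms])
    fix x
    have "replicate_pmf n p \<bind> (\<lambda>xs. return_pmf (x # xs)) = map_pmf ((#) x) (replicate_pmf n p)"
      by (simp add: map_pmf_def)
    then show "measure_pmf.prob (replicate_pmf n p \<bind> (\<lambda>xs. return_pmf (x # xs))) {xs. set xs \<subseteq> B}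
        \<le> indicator B x * measure_pmf.prob p B ^ n"
      using Suc by (cases "x \<in> B") (simp_all add: vimage_def)
  qed
  also have "\<dots> = measure_pmf.prob p B ^ Suc n" by simp
  finally show ?case .
qed simp

lemma prob_not_covers:
  assumes k: "2 \<le> k"
  shows "measure_pmf.prob (replicate_pmf n (moves b k)) {ms. \<not> covers b ms} \<le> real (b + 1) * (1 - 1 / real (b + 1)) ^ n"
proof -
  let ?P = "replicate_pmf n (moves b k)" and ?E = "\<lambda>v. {ms. set ms \<subseteq> {m. fst m \<in> - {v}}}"
  have "{ms. \<not> covers b ms} \<subseteq> (\<Union>v\<in>{0..b}. ?E v)" by (force simp: covers_def)
  then have "measure_pmf.prob ?P {ms. \<not> covers b ms} \<le> measure_pmf.prob ?P (\<Union>v\<in>{0..b}. ?E v)"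
    by (intro measure_pmf.finite_measure_mono) auto
  also have "\<dots> \<le> (\<Sum>v\<in>{0..b}. measure_pmf.prob ?P (?E v))"
    by (intro measure_pmf.finite_measure_subadditive_finite) auto
  also have "\<dots> \<le> (\<Sum>v\<in>{0..b}. (1 - 1 / real (b + 1)) ^ n)"
  proof (rule sum_mono)
    fix v assume v: "v \<in> {0..b}"
    have "measure_pmf.prob ?P (?E v) \<le> measure_pmf.prob (moves b k) {m. fst m \<in> - {v}} ^ n"
      using k by (intro prob_replicate_pmf_subset_le) simp
    also have "measure_pmf.prob (moves b k) {m. fst m \<in> - {v}} = real (card ({0..b} - {v})) / real (b + 1)"
      unfolding prob_moves_fst by (simp add: Diff_eq)
    also have "\<dots> = 1 - 1 / real (b + 1)" using v by (simp add: field_simps)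
    finally show "measure_pmf.prob ?P (?E v) \<le> (1 - 1 / real (b + 1)) ^ n" .
  qed
  also have "\<dots> = real (b + 1) * (1 - 1 / real (b + 1)) ^ n" by simp
  finally show ?thesis .
qed

lemma expectation_moves_of_bool_root:
  assumes "2 \<le> k"
  shows "measure_pmf.expectation (moves b k) (\<lambda>m. of_bool (fst m = 0) * a) = a / real (b + 1)"
proof -
  have "(\<lambda>m::nat \<times> nat. of_bool (fst m = 0)) = indicat_real {m. fst m \<in> {0}}"
    by (auto simp: fun_eq_iff indicator_def)
  moreover have "{0..b} \<inter> {0} = {0}" by auto
  ultimately show ?thesis using prob_moves_fst[of b k "{0}"] by simp
qed

lemma expectation_root_moves:
  assumes k: "2 \<le> k"
  shows "measure_pmf.expectation (replicate_pmf n (moves b k)) (\<lambda>ms. real (root_moves ms)) = real n / real (b + 1)"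
proof (induction n)
  case (Suc n)
  have "real (root_moves (m # ms)) = of_bool (fst m = 0) * 1 + real (root_moves ms)" for m ms
    by (simp add: root_moves_def)
  then have "measure_pmf.expectation (replicate_pmf (Suc n) (moves b k)) (\<lambda>ms. real (root_moves ms)) =
      measure_pmf.expectation (moves b k) (\<lambda>m. of_bool (fst m = 0) * 1 + real n / real (b + 1))"
    using k Suc by (simp add: expectation_replicate_pmf_Suc integrable_measure_pmf_finite del: replicate_pmf.simps)
  also have "\<dots> = 1 / real (b + 1) + real n / real (b + 1)"
    using k by (subst Bochner_Integration.integral_add)
      (simp_all only: expectation_moves_of_bool_root integrable_measure_pmf_finite finite_set_moves, simp)
  finally show ?case by (simp add: add_divide_distrib)
qed (simp add: root_moves_def)

section \<open>The record of leaf choices in its stationary law\<close>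

definition leaf_choices :: "nat \<Rightarrow> nat \<Rightarrow> (nat \<Rightarrow> nat) pmf" where
  "leaf_choices b k = Pi_pmf {1..b} 0 (\<lambda>_. pmf_of_set {1..k-1})"

lemma finite_set_leaf_choices [simp]: "2 \<le> k \<Longrightarrow> finite (set_pmf (leaf_choices b k))"
  unfolding leaf_choices_def by (subst set_Pi_pmf) (auto simp: set_pmf_of_set)

definition record_choice :: "nat \<times> nat \<Rightarrow> (nat \<Rightarrow> nat) \<Rightarrow> nat \<Rightarrow> nat" where
  "record_choice m lc = (if fst m = 0 then lc else lc(fst m := snd m))"

lemma leaf_choices_resample:
  assumes v: "v \<in> {1..b}"
  shows "bind_pmf (leaf_choices b k) (\<lambda>lc. map_pmf (\<lambda>c. lc(v := c)) (pmf_of_set {1..k-1})) = leaf_choices b k"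
proof -
  have ins: "leaf_choices b k = do {y \<leftarrow> pmf_of_set {1..k-1}; f \<leftarrow> Pi_pmf ({1..b} - {v}) 0 (\<lambda>_. pmf_of_set {1..k-1});
      return_pmf (f(v := y))}"
    using Pi_pmf_insert'[of "{1..b} - {v}" v 0 "\<lambda>_. pmf_of_set {1..k-1}"] v
    by (simp add: leaf_choices_def insert_absorb)
  have "bind_pmf (leaf_choices b k) (\<lambda>lc. map_pmf (\<lambda>c. lc(v := c)) (pmf_of_set {1..k-1})) =
      do {f \<leftarrow> Pi_pmf ({1..b} - {v}) 0 (\<lambda>_. pmf_of_set {1..k-1}); c \<leftarrow> pmf_of_set {1..k-1}; return_pmf (f(v := c))}"
    by (subst ins) (simp add: bind_assoc_pmf bind_return_pmf map_pmf_def)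
  also have "\<dots> = leaf_choices b k"
    unfolding ins by (rule bind_commute_pmf)
  finally show ?thesis .
qed

text \<open>A leaf move overwrites one coordinate of a product law by an independent copy, and a
  root move changes nothing.\<close>

lemma leaf_choices_stationary:
  "bind_pmf (leaf_choices b k) (\<lambda>lc. map_pmf (\<lambda>m. record_choice m lc) (moves b k)) = leaf_choices b k"
proof -
  let ?V = "pmf_of_set {0..b}" and ?C = "pmf_of_set {1..k-1}"
  have "bind_pmf (leaf_choices b k) (\<lambda>lc. map_pmf (\<lambda>m. record_choice m lc) (moves b k)) =
      bind_pmf (leaf_choices b k) (\<lambda>lc. bind_pmf ?V (\<lambda>v. map_pmf (\<lambda>c. record_choice (v, c) lc) ?C))"
    by (simp add: moves_def pair_pmf_def map_bind_pmf map_pmf_def bind_assoc_pmf bind_return_pmf)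
  also have "\<dots> = bind_pmf ?V (\<lambda>v. bind_pmf (leaf_choices b k) (\<lambda>lc. map_pmf (\<lambda>c. record_choice (v, c) lc) ?C))"
    by (rule bind_commute_pmf)
  also have "\<dots> = bind_pmf ?V (\<lambda>v. leaf_choices b k)"
  proof (rule bind_pmf_cong[OF refl])
    fix v assume "v \<in> set_pmf ?V"
    then have "v \<le> b" by (simp add: set_pmf_of_set)
    then show "bind_pmf (leaf_choices b k) (\<lambda>lc. map_pmf (\<lambda>c. record_choice (v, c) lc) ?C) = leaf_choices b k"
      using leaf_choices_resample[of v b k]
      by (cases "v = 0") (simp_all add: record_choice_def map_pmf_const bind_return_pmf')
  qed
  finally show ?thesis by simp
qed

text \<open>Started from its stationary law, the record has that law before every move,
  independently of the move itself. Each of the \<open>n\<close> moves thus contributes the same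
  mean, weighted by the chance \<open>1 / (b + 1)\<close> of hitting the root.\<close>

lemma expectation_root_cost:
  assumes k: "2 \<le> k"
  shows "measure_pmf.expectation (leaf_choices b k) (\<lambda>lc. measure_pmf.expectation (replicate_pmf n (moves b k)) (\<lambda>ms. root_cost b k ms lc))
    = real n / real (b + 1) * measure_pmf.expectation (leaf_choices b k) (\<lambda>lc. 1 / (real (missing b k lc) + 1))"
proof (induction n)
  case (Suc n)
  let ?Q = "leaf_choices b k" and ?M = "moves b k" and ?h = "\<lambda>lc. 1 / (real (missing b k lc) + 1)"
  let ?G = "\<lambda>lc. measure_pmf.expectation (replicate_pmf n ?M) (\<lambda>ms. root_cost b k ms lc)"
  have fin: "finite (set_pmf ?Q)" "finite (set_pmf ?M)" using k by auto
  have int: "integrable ?Q f" "integrable ?M g" "integrable (replicate_pmf n ?M) h" for f g h :: "_ \<Rightarrow> real"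
    using fin by (auto intro: integrable_measure_pmf_finite)
  have step: "measure_pmf.expectation (replicate_pmf (Suc n) ?M) (\<lambda>ms. root_cost b k ms lc) =
      ?h lc / real (b + 1) + measure_pmf.expectation ?M (\<lambda>m. ?G (record_choice m lc))" for lc
  proof -
    have "root_cost b k (m # ms) lc = of_bool (fst m = 0) * ?h lc + root_cost b k ms (record_choice m lc)" for m ms
      by (simp add: record_choice_def)
    then have "measure_pmf.expectation (replicate_pmf (Suc n) ?M) (\<lambda>ms. root_cost b k ms lc) =
        measure_pmf.expectation ?M (\<lambda>m. of_bool (fst m = 0) * ?h lc + ?G (record_choice m lc))"
      by (subst expectation_replicate_pmf_Suc[OF fin(2)]) (simp add: int del: root_cost.simps)
    also have "\<dots> = measure_pmf.expectation ?M (\<lambda>m. of_bool (fst m = 0) * ?h lc) +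
        measure_pmf.expectation ?M (\<lambda>m. ?G (record_choice m lc))"
      by (rule Bochner_Integration.integral_add) (rule int)+
    finally show ?thesis by (simp only: expectation_moves_of_bool_root[OF k])
  qed
  have "measure_pmf.expectation ?Q (\<lambda>lc. measure_pmf.expectation ?M (\<lambda>m. ?G (record_choice m lc))) =
      measure_pmf.expectation (bind_pmf ?Q (\<lambda>lc. map_pmf (\<lambda>m. record_choice m lc) ?M)) ?G"
    using fin by (subst expectation_bind_finite) auto
  also have "\<dots> = measure_pmf.expectation ?Q ?G" unfolding leaf_choices_stationary ..
  finally have total: "measure_pmf.expectation ?Q (\<lambda>lc. ?h lc / real (b + 1) + measure_pmf.expectation ?M (\<lambda>m. ?G (record_choice m lc))) =
      measure_pmf.expectation ?Q ?h / real (b + 1) + measure_pmf.expectation ?Q ?G"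
    by (simp only: Bochner_Integration.integral_add[OF int(1) int(1)] integral_divide_zero)
  show ?case unfolding step total Suc by (simp only: of_nat_Suc add_divide_distrib distrib_right) simp
qed simp

lemma prob_leaf_choices_avoid:
  assumes k: "2 \<le> k"
  shows "measure_pmf.prob (leaf_choices b k) {lc. lc ` {1..b} \<inter> A = {}} = (real (card ({1..k-1} - A)) / real (k - 1)) ^ b"
proof -
  have "{lc. lc ` {1..b} \<inter> A = {}} = Pi {1..b} (\<lambda>_. - A)" by auto
  then have "measure_pmf.prob (leaf_choices b k) {lc. lc ` {1..b} \<inter> A = {}} =
      (\<Prod>v\<in>{1..b}. measure_pmf.prob (pmf_of_set {1..k-1}) (- A))"
    by (simp add: leaf_choices_def measure_Pi_pmf_Pi)
  also have "\<dots> = (real (card ({1..k-1} - A)) / real (k - 1)) ^ b"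
    using k by (simp add: measure_pmf_of_set Diff_eq)
  finally show ?thesis .
qed

text \<open>Second moment method: the events that given colours are missed are negatively
  correlated, so the variance of their number is at most its mean \<mu>. Then
  \<open>2 / \<mu>\<close> from values above \<open>\<mu> / 2\<close> and \<open>4 / \<mu>\<close>
  from Chebyshev below add up to \<open>6 / \<mu>\<close>.\<close>

lemma expectation_inverse_missing:
  assumes k: "3 \<le> k"
  shows "measure_pmf.expectation (leaf_choices b k) (\<lambda>lc. 1 / (real (missing b k lc) + 1)) \<le> 6 / mean_missing b (k - 1)"
proof -
  let ?Q = "leaf_choices b k" and ?m = "real (k - 1)" and ?\<mu> = "mean_missing b (k - 1)" and ?C = "{1..k-1}"
  let ?S = "\<lambda>lc. real (missing b k lc)"
  define q where "q = (1 - 1 / ?m) ^ b"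
  have m: "?m \<ge> 2" using k by simp
  have \<mu>: "?\<mu> = ?m * q" "?\<mu> > 0" using m by (auto simp: mean_missing_def q_def)
  have int: "integrable ?Q f" for f :: "_ \<Rightarrow> real" using k by (auto intro: integrable_measure_pmf_finite)
  let ?E = "\<lambda>A. {lc::nat \<Rightarrow> nat. lc ` {1..b} \<inter> A = {}}"
  have S: "?S lc = (\<Sum>c\<in>?C. indicat_real (?E {c}) lc)" for lc
  proof -
    have "?C - lc ` {1..b} = ?C \<inter> {c. lc \<in> ?E {c}}" by auto
    then have "?S lc = real (card (?C \<inter> {c. lc \<in> ?E {c}}))" by (simp only: missing_def)
    also have "\<dots> = (\<Sum>c\<in>?C. indicat_real (?E {c}) lc)"
      by (simp add: indicator_def sum.If_cases flip: of_bool_def)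
    finally show ?thesis .
  qed
  have single: "measure_pmf.prob ?Q (?E {c}) = q" if "c \<in> ?C" for c
  proof -
    have "real (card (?C - {c})) / ?m = 1 - 1 / ?m" using that m by (simp add: field_simps of_nat_diff)
    then show ?thesis using prob_leaf_choices_avoid[of k b "{c}"] k by (simp only: q_def)
  qed
  have pair: "measure_pmf.prob ?Q (?E {c} \<inter> ?E {c'}) \<le> q\<^sup>2 + of_bool (c = c') * q"
    if c: "c \<in> ?C" "c' \<in> ?C" for c c'
  proof (cases "c = c'")
    case True
    then show ?thesis using single[OF c(1)] by simp
  next
    case False
    have "?E {c} \<inter> ?E {c'} = ?E {c, c'}" by auto
    then have "measure_pmf.prob ?Q (?E {c} \<inter> ?E {c'}) = (real (card (?C - {c, c'})) / ?m) ^ b"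
      using prob_leaf_choices_avoid[of k b "{c, c'}"] k by simp
    also have "card (?C - {c, c'}) = k - 1 - 2" using c False by (subst card_Diff_subset) auto
    also have "real (k - 1 - 2) / ?m = 1 - 2 / ?m" using m by (simp add: field_simps of_nat_diff)
    also have "(1 - 2 / ?m) ^ b \<le> ((1 - 1 / ?m)\<^sup>2) ^ b"
    proof (rule power_mono)
      have "(1 - 1 / ?m)\<^sup>2 = 1 - 2 / ?m + (1 / ?m)\<^sup>2" by (simp add: power2_diff)
      then show "1 - 2 / ?m \<le> (1 - 1 / ?m)\<^sup>2" by simp
      show "0 \<le> 1 - 2 / ?m" using m by simp
    qed
    also have "\<dots> = q\<^sup>2" by (simp add: q_def power_mult[symmetric] mult.commute)
    finally show ?thesis using False by simp
  qed
  have ES: "measure_pmf.expectation ?Q ?S = ?\<mu>"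
    unfolding S by (subst Bochner_Integration.integral_sum) (use int single \<mu>(1) in \<open>auto simp del: One_nat_def\<close>)
  have sq: "(?S lc)\<^sup>2 = (\<Sum>c\<in>?C. \<Sum>c'\<in>?C. indicat_real (?E {c} \<inter> ?E {c'}) lc)" for lc
    unfolding S power2_eq_square sum_product by (simp add: indicator_inter_arith)
  have "measure_pmf.expectation ?Q (\<lambda>lc. (?S lc)\<^sup>2) = (\<Sum>c\<in>?C. \<Sum>c'\<in>?C. measure_pmf.prob ?Q (?E {c} \<inter> ?E {c'}))"
    unfolding sq using int by (simp add: Bochner_Integration.integral_sum)
  also have "\<dots> \<le> (\<Sum>c\<in>?C. \<Sum>c'\<in>?C. q\<^sup>2 + of_bool (c = c') * q)"
    by (intro sum_mono pair)
  also have "\<dots> = ?m * (?m * q\<^sup>2 + q)"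
    using m by (simp add: sum.distrib of_bool_def if_distrib[of "\<lambda>z. z * _"] cong: if_cong)
  also have "\<dots> = ?\<mu>\<^sup>2 + ?\<mu>"
    unfolding \<mu>(1) by (simp add: power2_eq_square algebra_simps)
  finally have ES2: "measure_pmf.expectation ?Q (\<lambda>lc. (?S lc)\<^sup>2) \<le> ?\<mu>\<^sup>2 + ?\<mu>" .
  \<comment> \<open>Written as a polynomial in \<open>s\<close>, so that integrating it calls only
    for the first two moments.\<close>
  have point: "1 / (s + 1) \<le> 6 / ?\<mu> + 4 / ?\<mu>\<^sup>2 * s\<^sup>2 - 8 / ?\<mu> * s + (4 - 4 / ?\<mu>)" if "s \<ge> 0" for s :: real
  proof -
    have "1 / (s + 1) \<le> 2 / ?\<mu> + 4 * (s - ?\<mu>)\<^sup>2 / ?\<mu>\<^sup>2"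
    proof (cases "s \<ge> ?\<mu> / 2")
      case True
      then have "1 / (s + 1) \<le> 1 / (?\<mu> / 2)" using \<mu>(2) by (intro divide_left_mono mult_pos_pos) auto
      then show ?thesis by (simp add: add_increasing2)
    next
      case False
      then have "?\<mu> / 2 \<le> \<bar>s - ?\<mu>\<bar>" by linarith
      then have "(?\<mu> / 2)\<^sup>2 \<le> \<bar>s - ?\<mu>\<bar>\<^sup>2" using \<mu>(2) by (intro power_mono) auto
      then have "1 \<le> 4 * (s - ?\<mu>)\<^sup>2 / ?\<mu>\<^sup>2" using \<mu>(2) by (simp add: field_simps)
      moreover have "1 / (s + 1) \<le> 1" using that by simp
      moreover have "0 \<le> 2 / ?\<mu>" using \<mu>(2) by simp
      ultimately show ?thesis by linarith
    qed
    also have "\<dots> = 6 / ?\<mu> + 4 / ?\<mu>\<^sup>2 * s\<^sup>2 - 8 / ?\<mu> * s + (4 - 4 / ?\<mu>)"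
      using \<mu>(2) by (simp add: power2_diff field_simps power2_eq_square)
    finally show ?thesis .
  qed
  have "measure_pmf.expectation ?Q (\<lambda>lc. 1 / (?S lc + 1)) \<le>
      measure_pmf.expectation ?Q (\<lambda>lc. 6 / ?\<mu> + 4 / ?\<mu>\<^sup>2 * (?S lc)\<^sup>2 - 8 / ?\<mu> * ?S lc + (4 - 4 / ?\<mu>))"
    by (rule integral_mono[OF int int]) (rule point, simp)
  also have "\<dots> = 6 / ?\<mu> + 4 / ?\<mu>\<^sup>2 * measure_pmf.expectation ?Q (\<lambda>lc. (?S lc)\<^sup>2) - 8 / ?\<mu> * measure_pmf.expectation ?Q ?S + (4 - 4 / ?\<mu>)"
    using int by simp
  also have "\<dots> \<le> 6 / ?\<mu> + 4 / ?\<mu>\<^sup>2 * (?\<mu>\<^sup>2 + ?\<mu>) - 8 / ?\<mu> * ?\<mu> + (4 - 4 / ?\<mu>)"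
    unfolding ES using ES2 \<mu>(2) by (intro add_mono diff_mono mult_left_mono) auto
  also have "\<dots> = 6 / ?\<mu>"
    using \<mu>(2) by (simp add: field_simps power2_eq_square)
  finally show ?thesis .
qed

section \<open>From coalescence to mixing\<close>

lemma sum_pmf_diff_le_coupling:
  fixes J :: "('a \<times> 'a) pmf"
  assumes S: "finite S"
  shows "(\<Sum>t\<in>S. \<bar>pmf (map_pmf fst J) t - pmf (map_pmf snd J) t\<bar>) \<le> 2 * measure_pmf.prob J {z. fst z \<noteq> snd z}"
proof -
  let ?F = "\<lambda>t. {z. fst z = t \<and> fst z \<noteq> snd z}" and ?G = "\<lambda>t. {z. snd z = t \<and> fst z \<noteq> snd z}"
  let ?H = "\<lambda>t::'a. {z. fst z = t \<and> snd z = t}"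
  \<comment> \<open>The mass where both coordinates equal \<open>t\<close> is common to the two
    marginals and cancels.\<close>
  have "\<bar>pmf (map_pmf fst J) t - pmf (map_pmf snd J) t\<bar> \<le> measure_pmf.prob J (?F t) + measure_pmf.prob J (?G t)" for t
  proof -
    have "pmf (map_pmf fst J) t = measure_pmf.prob J (?H t \<union> ?F t)"
      by (auto simp: pmf_map intro!: arg_cong2[where f = measure])
    also have "\<dots> = measure_pmf.prob J (?H t) + measure_pmf.prob J (?F t)"
      by (rule measure_pmf.finite_measure_Union) auto
    finally have 1: "pmf (map_pmf fst J) t = measure_pmf.prob J (?H t) + measure_pmf.prob J (?F t)" .
    have "pmf (map_pmf snd J) t = measure_pmf.prob J (?H t \<union> ?G t)"
      by (auto simp: pmf_map intro!: arg_cong2[where f = measure])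
    also have "\<dots> = measure_pmf.prob J (?H t) + measure_pmf.prob J (?G t)"
      by (rule measure_pmf.finite_measure_Union) auto
    finally have 2: "pmf (map_pmf snd J) t = measure_pmf.prob J (?H t) + measure_pmf.prob J (?G t)" .
    have "0 \<le> measure_pmf.prob J (?F t)" "0 \<le> measure_pmf.prob J (?G t)" by simp_all
    then show ?thesis unfolding 1 2 by linarith
  qed
  then have "(\<Sum>t\<in>S. \<bar>pmf (map_pmf fst J) t - pmf (map_pmf snd J) t\<bar>) \<le>
      (\<Sum>t\<in>S. measure_pmf.prob J (?F t)) + (\<Sum>t\<in>S. measure_pmf.prob J (?G t))"
    by (simp add: sum_mono flip: sum.distrib)
  also have "(\<Sum>t\<in>S. measure_pmf.prob J (?F t)) = measure_pmf.prob J (\<Union>t\<in>S. ?F t)"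
    using S by (intro measure_pmf.finite_measure_finite_Union[symmetric]) (auto simp: disjoint_family_on_def)
  also have "(\<Sum>t\<in>S. measure_pmf.prob J (?G t)) = measure_pmf.prob J (\<Union>t\<in>S. ?G t)"
    using S by (intro measure_pmf.finite_measure_finite_Union[symmetric]) (auto simp: disjoint_family_on_def)
  also have "measure_pmf.prob J (\<Union>t\<in>S. ?F t) + measure_pmf.prob J (\<Union>t\<in>S. ?G t) \<le>
      measure_pmf.prob J {z. fst z \<noteq> snd z} + measure_pmf.prob J {z. fst z \<noteq> snd z}"
    by (intro add_mono measure_pmf.finite_measure_mono) auto
  finally show ?thesis by simp
qed

definition three_covers :: "nat \<Rightarrow> (nat \<times> nat) list \<Rightarrow> bool" where
  "three_covers b ms \<longleftrightarrow> (\<exists>ms1 ms2 ms3. ms = ms1 @ ms2 @ ms3 \<and> covers b ms1 \<and> covers b ms2 \<and> covers b ms3)"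

lemma prob_not_three_covers:
  assumes k: "2 \<le> k"
  shows "measure_pmf.prob (replicate_pmf (n + (n + n)) (moves b k)) {ms. \<not> three_covers b ms}
    \<le> 3 * measure_pmf.prob (replicate_pmf n (moves b k)) {ms. \<not> covers b ms}"
proof -
  let ?P = "replicate_pmf n (moves b k)"
  let ?e = "measure_pmf.prob ?P {ms. \<not> covers b ms}"
  have fin: "finite (set_pmf ?P)" using k by simp
  have split: "replicate_pmf (n + (n + n)) (moves b k) =
      bind_pmf ?P (\<lambda>a. bind_pmf ?P (\<lambda>b. bind_pmf ?P (\<lambda>c. return_pmf (a @ b @ c))))"
    by (simp add: replicate_pmf_distrib bind_assoc_pmf bind_return_pmf)
  have "measure_pmf.prob (replicate_pmf (n + (n + n)) (moves b k)) {ms. \<not> three_covers b ms} \<le> ?e + (?e + (?e + 0))"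
    unfolding split
  proof (intro measure_bind_pmf_le fin)
    fix ms1 ms2 ms3 assume "ms1 \<notin> {ms. \<not> covers b ms}" "ms2 \<notin> {ms. \<not> covers b ms}" "ms3 \<notin> {ms. \<not> covers b ms}"
    then have "three_covers b (ms1 @ ms2 @ ms3)" unfolding three_covers_def by blast
    then show "measure_pmf.prob (return_pmf (ms1 @ ms2 @ ms3)) {ms. \<not> three_covers b ms} \<le> 0" by simp
  qed simp_all
  then show ?thesis by simp
qed

lemma prob_not_coalesced:
  assumes xy: "x \<in> colorings b k" "y \<in> colorings b k" and k: "3 \<le> k" and L: "0 < L"
  shows "measure_pmf.prob (bind_pmf (replicate_pmf (n + (n + n)) (moves b k)) (\<lambda>ms. run (couple_move b k) ms (x, y))) {z. fst z \<noteq> snd z}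
    \<le> 3 * (real (b + 1) * (1 - 1 / real (b + 1)) ^ n) + (real (3 * n) / real (b + 1)) / L
      + 2 * (3 + 2 * L) * (real (3 * n) / real (b + 1) * (6 / mean_missing b (k - 1)))"
proof -
  let ?W = "replicate_pmf (n + (n + n)) (moves b k)" and ?Q = "leaf_choices b k" and ?D = "{z. fst z \<noteq> snd z}"
  let ?p = "measure_pmf.prob (bind_pmf ?W (\<lambda>ms. run (couple_move b k) ms (x, y))) ?D"
  let ?B = "2 * (3 + 2 * L)" and ?r = "real (3 * n) / real (b + 1)"
  let ?cost = "\<lambda>lc. measure_pmf.expectation ?W (\<lambda>ms. root_cost b k ms lc)"
  have k2: "2 \<le> k" using k by simp
  have fin: "finite (set_pmf ?W)" "finite (set_pmf ?Q)" using k2 by simp_all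
  have intW: "integrable ?W f" for f :: "_ \<Rightarrow> real" using fin by (auto intro: integrable_measure_pmf_finite)
  have intQ: "integrable ?Q f" for f :: "_ \<Rightarrow> real" using fin by (auto intro: integrable_measure_pmf_finite)
  let ?A = "3 * (real (b + 1) * (1 - 1 / real (b + 1)) ^ n) + ?r / L"
  have each: "?p \<le> ?A + ?B * ?cost lc" for lc
  proof -
    have "?p \<le> measure_pmf.expectation ?W
        (\<lambda>ms. indicator {ms. \<not> three_covers b ms} ms + real (root_moves ms) / L + ?B * root_cost b k ms lc)"
    proof (rule measure_bind_pmf_le_integral[OF fin(1)])
      fix ms assume ms: "ms \<in> set_pmf ?W"
      have set: "set ms \<subseteq> {0..b} \<times> {1..k-1}" using ms k2 by (auto simp: set_replicate_pmf set_moves)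
      have nn: "0 \<le> ?B * root_cost b k ms lc" "0 \<le> real (root_moves ms) / L"
        using L root_cost_nonneg by (simp_all add: mult_nonneg_nonneg)
      show "measure_pmf.prob (run (couple_move b k) ms (x, y)) ?D \<le>
          indicator {ms. \<not> three_covers b ms} ms + real (root_moves ms) / L + ?B * root_cost b k ms lc"
      proof (cases "three_covers b ms \<and> real (root_moves ms) \<le> L")
        case True
        then obtain ms1 ms2 ms3 where "ms = ms1 @ ms2 @ ms3" "covers b ms1" "covers b ms2" "covers b ms3"
          unfolding three_covers_def by blast
        then have "measure_pmf.prob (run (couple_move b k) ms (x, y)) ?D \<le> ?B * root_cost b k ms lc"
          using coalescence_bound[OF xy] set True by blast
        moreover have "0 \<le> indicat_real {ms. \<not> three_covers b ms} ms" by simp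
        ultimately show ?thesis using nn by linarith
      next
        case False
        \<comment> \<open>Either the indicator or the ratio is at least 1, so the trivial bound
          suffices; for the ratio this is Markov's inequality.\<close>
        then have "1 \<le> indicator {ms. \<not> three_covers b ms} ms + real (root_moves ms) / L"
          using L nn(2) by (auto simp: indicator_def field_simps)
        then show ?thesis using nn(1) measure_pmf.prob_le_1[of "run (couple_move b k) ms (x, y)" ?D] by linarith
      qed
    qed
    also have "\<dots> = measure_pmf.prob ?W {ms. \<not> three_covers b ms} +
        measure_pmf.expectation ?W (\<lambda>ms. real (root_moves ms)) / L + ?B * ?cost lc"
      by (simp add: intW)
    also have "measure_pmf.prob ?W {ms. \<not> three_covers b ms} \<le> 3 * (real (b + 1) * (1 - 1 / real (b + 1)) ^ n)"
      using prob_not_three_covers[OF k2, of n b] prob_not_covers[OF k2, of n b] by linarith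
    also have "measure_pmf.expectation ?W (\<lambda>ms. real (root_moves ms)) = ?r"
      by (simp only: expectation_root_moves[OF k2]) simp
    finally show ?thesis by simp
  qed
  \<comment> \<open>The left side does not involve \<open>lc\<close>, so the bound may be averaged
    over the stationary law of the record.\<close>
  have "?p = measure_pmf.expectation ?Q (\<lambda>lc. ?p)" by simp
  also have "\<dots> \<le> measure_pmf.expectation ?Q (\<lambda>lc. ?A + ?B * ?cost lc)"
    by (rule integral_mono[OF intQ intQ each])
  also have "\<dots> = ?A + ?B * measure_pmf.expectation ?Q ?cost"
    by (simp add: intQ)
  also have "measure_pmf.expectation ?Q ?cost \<le> ?r * (6 / mean_missing b (k - 1))"
  proof -
    have "measure_pmf.expectation ?Q ?cost = ?r * measure_pmf.expectation ?Q (\<lambda>lc. 1 / (real (missing b k lc) + 1))"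
      by (simp only: expectation_root_cost[OF k2]) simp
    also have "\<dots> \<le> ?r * (6 / mean_missing b (k - 1))"
      using expectation_inverse_missing[OF k, of b] by (intro mult_left_mono) auto
    finally show ?thesis .
  qed
  finally show ?thesis using L by simp
qed

text \<open>The error budget is \<open>1/15 + 1/20 + 1/20 = 1/6\<close>, which is below
  \<open>1 / (2 * exp 1)\<close> as \<open>exp 1 \<le> 3\<close>. The first share,
  \<open>3 / (b + 1)\<close> for unvisited vertices, is where 44 comes from.\<close>

lemma mixes_by_three_blocks:
  assumes b: "44 \<le> b" and k: "3 \<le> k"
    and small: "root_moves_bound b * (2 * (3 + 40 * root_moves_bound b)) * (6 / mean_missing b (k - 1)) \<le> 1/20"
  shows "mixes_by b k (3 * block_length b)"
  unfolding mixes_by_def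
proof
  fix s assume s: "s \<in> colorings b k"
  let ?n = "block_length b"
  have three: "3 * ?n = ?n + (?n + ?n)" by simp
  have "tv_dist b k (3 * ?n) s \<le> 1 / 6"
  proof (rule tv_dist_le_if_pairwise[OF s])
    fix s' assume s': "s' \<in> colorings b k"
    let ?W = "replicate_pmf (?n + (?n + ?n)) (moves b k)"
    let ?J = "bind_pmf ?W (\<lambda>ms. run (couple_move b k) ms (s, s'))"
    have k2: "2 \<le> k" using k by simp
    have set: "set ms \<subseteq> {0..b} \<times> {1..k-1}" if "ms \<in> set_pmf ?W" for ms
      using that k2 by (auto simp: set_replicate_pmf set_moves)
    have fst: "map_pmf fst ?J = bind_pmf ?W (\<lambda>ms. run (apply_move b k) ms s)"
      unfolding map_bind_pmf using map_run_couple_move(1)[OF s s' set] by (intro bind_pmf_cong refl) auto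
    have snd: "map_pmf snd ?J = bind_pmf ?W (\<lambda>ms. run (apply_move b k) ms s')"
      unfolding map_bind_pmf using map_run_couple_move(2)[OF s s' set] by (intro bind_pmf_cong refl) auto
    have "(\<Sum>t\<in>colorings b k. \<bar>glauber_Pt b k (3 * ?n) s t - glauber_Pt b k (3 * ?n) s' t\<bar>) =
        (\<Sum>t\<in>colorings b k. \<bar>pmf (map_pmf fst ?J) t - pmf (map_pmf snd ?J) t\<bar>)"
      unfolding fst snd three
      by (intro sum.cong refl) (simp only: pmf_run_random_moves[OF s _ k2] pmf_run_random_moves[OF s' _ k2])
    also have "\<dots> \<le> 2 * measure_pmf.prob ?J {z. fst z \<noteq> snd z}"
      by (rule sum_pmf_diff_le_coupling) simp
    also have "measure_pmf.prob ?J {z. fst z \<noteq> snd z} \<le> 1 / 6"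
    proof -
      define q where "q = root_moves_bound b"
      define r where "r = real (3 * ?n) / real (b + 1)"
      define w where "w = 6 / mean_missing b (k - 1)"
      have q: "0 < q" by (simp add: q_def root_moves_bound_def add_nonneg_pos)
      have r: "0 \<le> r" "r \<le> q" using blocks_per_vertex[of b] b by (simp_all add: r_def q_def)
      have w: "0 \<le> w" using k by (simp add: w_def mean_missing_def)
      \<comment> \<open>The cutoff for root moves is 20 times the bound on their mean, so Markov
        loses \<open>1/20\<close>; it also produces the 40 in the smallness hypothesis.\<close>
      have "measure_pmf.prob ?J {z. fst z \<noteq> snd z} \<le>
          3 * (real (b + 1) * (1 - 1 / real (b + 1)) ^ ?n) + r / (20 * q) + 2 * (3 + 2 * (20 * q)) * (r * w)"
        unfolding r_def w_def using q by (intro prob_not_coalesced[OF s s' k]) simp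
      also have "3 * (real (b + 1) * (1 - 1 / real (b + 1)) ^ ?n) \<le> 3 * (1 / real (b + 1))"
        using unvisited_bound[of b] b by simp
      also have "3 * (1 / real (b + 1)) \<le> 1 / 15" using b by (simp add: field_simps)
      also have "r / (20 * q) \<le> 1 / 20" using r q by (simp add: field_simps)
      also have "2 * (3 + 2 * (20 * q)) * (r * w) \<le> 2 * (3 + 2 * (20 * q)) * (q * w)"
        using r w q by (intro mult_left_mono mult_right_mono) auto
      also have "\<dots> \<le> 1 / 20" using small by (simp add: q_def w_def mult_ac)
      finally show ?thesis by simp
    qed
    finally show "(\<Sum>t\<in>colorings b k. \<bar>glauber_Pt b k (3 * ?n) s t - glauber_Pt b k (3 * ?n) s' t\<bar>) \<le> 2 * (1 / 6)"
      by simp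
  qed
  also have "1 / 6 \<le> 1 / (2 * exp (1::real))"
    using exp_le by (intro divide_left_mono) auto
  finally show "tv_dist b k (3 * ?n) s \<le> 1 / (2 * exp 1)" .
qed

theorem theorem5:
  fixes C :: real
  assumes "C > 1"
  shows "\<exists>b0 > 0. \<exists>c > 0. \<forall>b k :: nat. real b > b0 \<longrightarrow> real k \<ge> C * real b / ln (real b) \<longrightarrow>
           (\<exists>n. mixes_by b k n) \<and> real (mixing_time b k) \<le> c * real b * ln (real b) \<and>
           lambda_star b k < 1 \<and> relaxation_time b k \<le> c * real b * ln (real b)"
proof -
  obtain B where B: "\<And>b k. b \<ge> B \<Longrightarrow> real k \<ge> C * real b / ln (real b) \<Longrightarrow> 3 \<le> k \<and>
      root_moves_bound b * (2 * (3 + 40 * root_moves_bound b)) * (6 / mean_missing b (k - 1)) \<le> 1/20"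
    using root_failure_small[OF assms] unfolding eventually_sequentially by blast
  have "(\<exists>n. mixes_by b k n) \<and> real (mixing_time b k) \<le> 30 * real b * ln (real b) \<and>
      lambda_star b k < 1 \<and> relaxation_time b k \<le> 30 * real b * ln (real b)"
    if "real (max B 44) < real b" and k: "C * real b / ln (real b) \<le> real k" for b k :: nat
  proof -
    have b: "B \<le> b" "44 \<le> b" using that(1) by auto
    let ?n = "3 * block_length b"
    have k3: "3 \<le> k" and mix: "mixes_by b k ?n"
      using B[OF b(1) k] mixes_by_three_blocks[OF b(2)] by auto
    have len: "real ?n + 1 \<le> 30 * real b * ln (real b)" using three_blocks_le[of b] b by simp
    have "mixing_time b k \<le> ?n" unfolding mixing_time_def using mix by (rule Least_le)
    then have "real (mixing_time b k) \<le> real ?n" by (rule of_nat_mono)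
    moreover have "lambda_star b k < 1" "relaxation_time b k \<le> real ?n + 1"
      using relaxation_time_le[OF mix _ k3] b by simp_all
    ultimately show ?thesis using mix len by (intro conjI exI[of _ ?n]) linarith+
  qed
  moreover have "0 < real (max B 44)" "0 < (30::real)" by auto
  ultimately show ?thesis by blast
qed

end
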